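(* Let $\mu_0=\mathcal N(0,\mathcal C)$ be a centred Gaussian measure on a Hilbert space $H$ and let $(X,\|\cdot\|_X)$ be a Banach space, $X\subseteq H$, with $\mu_0(X)=1$. Let $\Phi:X\to\mathbb R$ and $\Phi^N:X\to\mathbb R$ ($N\in\mathbb N$) be measurable and satisfy the following two conditions, with constants uniform in $N$: (i) for every $\epsilon>0$ there is $M=M(\epsilon)\in\mathbb R$ such that for all $u\in X$ and all $N$, $\Phi(u)\ge M-\epsilon\|u\|_X^2$ and $\Phi^N(u)\ge M-\epsilon\|u\|_X^2$; (ii) for every $r>0$ there is $L=L(r)>0$ such that for all $u\in X$ with $\|u\|_X<r$ and all $N$, $\Phi(u)\le L(r)$ and $\Phi^N(u)\le L(r)$. Assume also that for any $\epsilon>0$ there is $K=K(\epsilon)>0$ such that, for all $u\in X$ and all $N$, $$|\Phi(u)-\Phi^N(u)|\le K\exp\bigl(\epsilon\|u\|_X^2\bigr)\psi(N),$$ where $\psi(N)\to0$ as $N\to\infty$. Define probability measures $\mu,\mu^N$ on $X$ by $$\frac{d\mu}{d\mu_0}(u)=\frac1Z\exp(-\Phi(u)),\quad Z=\int_X\exp(-\Phi(u))\,d\mu_0(u),\qquad \frac{d\mu^N}{d\mu_0}(u)=\frac1{Z^N}\exp(-\Phi^N(u)),\quad Z^N=\int_X\exp(-\Phi^N(u))\,d\mu_0(u).$$ Then there is a constant $C$, independent of $N$, such that $$d_{\rm Hell}(\mu,\mu^N)\le C\psi(N).$$ Consequently all moments of $\|u\|_X$ under $\mu$ and $\mu^N$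 are $\mathcal O(\psi(N))$ close. In particular the means of $\mu$ and $\mu^N$ are $\mathcal O(\psi(N))$ close in $X$ and, in the case where $X$ is a Hilbert space, the covariance operators of $\mu$ and $\mu^N$ are $\mathcal O(\psi(N))$ close in operator norm.
   Context: The Hellinger distance between probability measures $\mu,\mu'$ both absolutely continuous with respect to a reference measure $\nu$ is $$d_{\rm Hell}(\mu,\mu')=\Bigl(\tfrac12\int\Bigl(\sqrt{\tfrac{d\mu}{d\nu}}-\sqrt{\tfrac{d\mu'}{d\nu}}\Bigr)^2d\nu\Bigr)^{1/2},$$ which does not depend on the choice of $\nu$. "All moments of $\|u\|_X$ are $\mathcal O(\psi(N))$ close" means: for each $p$ there is $C_p$ independent of $N$ with $|\mathbb E^{\mu}\|u\|_X^p-\mathbb E^{\mu^N}\|u\|_X^p|\le C_p\psi(N)$. Standing conventions: $H$ and $X$ are separable, $X$ is continuously embedded in $H$, so $\mu_0$ is regarded as a Gaussian measure on $X$ and Fernique's theorem applies (there is $a>0$ with $\int_X\exp(a\|u\|_X^2)\,d\mu_0(u)<\infty$). *)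

theory Defs
  imports "HOL-Probability.Probability"
begin

text \<open>The normal law on the real line with mean \<open>m\<close> and variance \<open>v \<ge> 0\<close>; the degenerate case
  \<open>v = 0\<close> is the Dirac measure at \<open>m\<close>.\<close>

definition normal_law :: "real \<Rightarrow> real \<Rightarrow> real measure" where
  "normal_law m v =
    (if v = 0 then return borel m
     else density lborel (\<lambda>x. ennreal (normal_density m (sqrt v) x)))"

text \<open>\<open>gaussian_measure m Cov M\<close> says that \<open>M = N(m, Cov)\<close> on the separable Hilbert space
  \<open>'h\<close>: every continuous linear functional (Riesz) has a normal law under \<open>M\<close>, with the mean and
  variance prescribed by \<open>m\<close> and \<open>Cov\<close>.\<close>

definition gaussian_measure ::
  "'h \<Rightarrow> ('h \<Rightarrow> 'h) \<Rightarrow> 'h::{real_inner, banach, second_countable_topology} measure \<Rightarrow> bool" where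
  "gaussian_measure m Cov M \<longleftrightarrow>
     prob_space M \<and> sets M = sets borel \<and>
     bounded_linear Cov \<and>
     (\<forall>h k. Cov h \<bullet> k = h \<bullet> Cov k) \<and> (\<forall>h. 0 \<le> Cov h \<bullet> h) \<and>
     (\<forall>h. distr M borel (\<lambda>u. u \<bullet> h) = normal_law (m \<bullet> h) (Cov h \<bullet> h))"

text \<open>A Borel measure \<open>M\<close> on \<open>'h\<close> regarded as a Borel measure on a space \<open>'x\<close> included in \<open>'h\<close>
  through an injective continuous map \<open>\<iota>\<close>: a set \<open>A\<close> gets the mass of its copy \<open>\<iota> ` A\<close>.
  For Polish \<open>'x\<close> and \<open>'h\<close> the image of a Borel set under such a map is Borel (Lusin--Souslin),
  so this is countably additive on the Borel sets of \<open>'x\<close>.\<close>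

definition measure_on_subspace ::
  "('x::topological_space \<Rightarrow> 'h::topological_space) \<Rightarrow> 'h measure \<Rightarrow> 'x measure" where
  "measure_on_subspace \<iota> M = measure_of UNIV (sets borel) (\<lambda>A. emeasure M (\<iota> ` A))"

definition normalisation :: "'a measure \<Rightarrow> ('a \<Rightarrow> real) \<Rightarrow> real" where
  "normalisation M \<Phi> = (\<integral>u. exp (- \<Phi> u) \<partial>M)"

definition reweighted_measure :: "'a measure \<Rightarrow> ('a \<Rightarrow> real) \<Rightarrow> 'a measure" where
  "reweighted_measure M \<Phi> =
     density M (\<lambda>u. ennreal (1 / normalisation M \<Phi> * exp (- \<Phi> u)))"

text \<open>\<open>\<nu>\<close> is the reference measure, with respect to which \<open>M\<close> and \<open>M'\<close> are assumed to be
  absolutely continuous.\<close>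

definition hellinger_dist :: "'a measure \<Rightarrow> 'a measure \<Rightarrow> 'a measure \<Rightarrow> real" where
  "hellinger_dist \<nu> M M' =
     sqrt (1 / 2 * (\<integral>u. (sqrt (enn2real (RN_deriv \<nu> M u)) -
                         sqrt (enn2real (RN_deriv \<nu> M' u)))\<^sup>2 \<partial>\<nu>))"

definition mean :: "'x::{banach, second_countable_topology} measure \<Rightarrow> 'x" where
  "mean M = (\<integral>u. u \<partial>M)"

text \<open>\<open>ip\<close> is an inner product inducing the given norm. A complete normed space is a Hilbert space
  iff such an \<open>ip\<close> exists (and then it is unique); this expresses the Hilbert property of \<open>'x\<close> as
  a hypothesis inside a statement about general Banach spaces.\<close>

definition norm_inner_product :: "('x::real_normed_vector \<Rightarrow> 'x \<Rightarrow> real) \<Rightarrow> bool" where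
  "norm_inner_product ip \<longleftrightarrow>
     (\<forall>u v. ip u v = ip v u) \<and> (\<forall>v. linear (\<lambda>u. ip u v)) \<and> (\<forall>u. ip u u = (norm u)\<^sup>2)"

text \<open>\<open>Cov h = E [\<langle>u - m, h\<rangle> (u - m)]\<close> with \<open>m = E u\<close>, that is, the expectation of
  \<open>(u - m) \<otimes> (u - m)\<close>.\<close>

definition covariance_operator ::
  "('x \<Rightarrow> 'x \<Rightarrow> real) \<Rightarrow> 'x::{banach, second_countable_topology} measure \<Rightarrow> 'x \<Rightarrow> 'x" where
  "covariance_operator ip M h = (\<integral>u. ip (u - mean M) h *\<^sub>R (u - mean M) \<partial>M)"

end

theory Submission
  imports Defs
begin

text \<open>By Lusin's separation argument the inverse of the embedding \<open>\<iota>\<close> is Borel, so that \<open>\<mu>X\<close> is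
  the image of \<open>\<mu>0\<close> under it. A finite measure on a separable Hilbert space is determined by its
  characteristic functional, hence \<open>\<mu>0 \<Otimes> \<mu>0\<close> is invariant under the rotation by 45 degrees, and this
  invariance passes to \<open>\<mu>X\<close>. Fernique's argument then gives \<open>\<integral> exp (a * (norm u)\<^sup>2) \<partial>\<mu>X < \<infinity>\<close> for some
  \<open>a > 0\<close>. After absorbing \<open>ln Z\<close> into the potential, the densities of \<open>\<mu>\<close> and \<open>\<mu>N\<close> with respect to
  \<open>\<mu>X\<close>, and likewise their square roots, differ pointwise by at most
  \<open>C * \<psi> N * exp (\<delta> * (norm u)\<^sup>2)\<close> with \<open>\<delta>\<close> as small as desired. All bounds follow by
  integrating this estimate.\<close>

section \<open>Borel images under injective continuous maps\<close>

text \<open>The hypothesis on \<open>\<mu>0\<close> speaks of the functionals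
  \<open>u \<bullet> h\<close> of the large space, whereas every estimate involves the norm of the
  small space, which in general is not continuous for the norm of the large one. Gaussianity is
  therefore not carried over as a statement about functionals on the small space. What is carried
  over is an algebraic consequence, the invariance of the product measure under \<open>rot\<close>:
  it survives any Borel isomorphism that respects the linear structure, and Fernique's argument runs
  on it. The Borel inverse of \<open>\<iota>\<close> is also what makes
  \<open>measure_on_subspace\<close> a genuine measure, since its set function refers to images of
  Borel sets. Absorbing \<open>ln Z\<close> avoids splitting each difference into a part from the
  potentials and a part from the normalising constants. The freedom in \<open>\<epsilon>\<close> is
  spent on fitting all exponents into the single \<open>a\<close> that Fernique's theorem provides:
  two factors \<open>exp (a / 2 * (norm u)\<^sup>2)\<close> are allowed per integral.\<close>

lemma borel_separated_UN:
  fixes P Q :: "nat \<Rightarrow> 'b::topological_space set"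
  assumes "\<And>i j. \<exists>B\<in>sets borel. P i \<subseteq> B \<and> Q j \<inter> B = {}"
  shows "\<exists>B\<in>sets borel. (\<Union>i. P i) \<subseteq> B \<and> (\<Union>j. Q j) \<inter> B = {}"
proof -
  obtain B where B: "\<And>i j. B i j \<in> sets borel" "\<And>i j. P i \<subseteq> B i j" "\<And>i j. Q j \<inter> B i j = {}"
    using assms by metis
  show ?thesis
  proof (intro bexI conjI)
    \<comment> \<open>For fixed \<open>i\<close> the intersection over \<open>j\<close> still
      contains \<open>P i\<close> and avoids every \<open>Q j\<close>; the union over
      \<open>i\<close> then catches all \<open>P i\<close>.\<close>
    show "(\<Union>i. \<Inter>j. B i j) \<in> sets borel" using B(1) by auto
    show "(\<Union>i. P i) \<subseteq> (\<Union>i. \<Inter>j. B i j)" using B(2) by blast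
    show "(\<Union>j. Q j) \<inter> (\<Union>i. \<Inter>j. B i j) = {}" using B(3) by blast
  qed
qed

text \<open>Lusin's argument: if the images were not separable, one could shrink both sets to points
  keeping the images inseparable, which contradicts continuity and the Hausdorff property.\<close>

theorem lusin_separation:
  fixes f :: "'a::{complete_space, second_countable_topology} \<Rightarrow> 'b::t2_space"
  assumes cont: "continuous_on UNIV f" and "closed P" "closed Q" and disj: "f ` P \<inter> f ` Q = {}"
  shows "\<exists>B\<in>sets borel. f ` P \<subseteq> B \<and> f ` Q \<inter> B = {}"
proof (rule ccontr)
  define sep where "sep S T \<longleftrightarrow> (\<exists>B\<in>sets borel. f ` S \<subseteq> B \<and> f ` T \<inter> B = {})" for S T
  assume "\<not> (\<exists>B\<in>sets borel. f ` P \<subseteq> B \<and> f ` Q \<inter> B = {})"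
  then have nsep: "\<not> sep P Q" by (simp add: sep_def)
  obtain D :: "'a set" where "countable D" and D: "\<And>X. open X \<Longrightarrow> X \<noteq> {} \<Longrightarrow> \<exists>d\<in>D. d \<in> X"
    using countable_dense_exists by blast
  then have "D \<noteq> {}" by blast
  define d where "d = from_nat_into D"
  have cover: "\<exists>i. x \<in> cball (d i) e" if e: "e > 0" for x e
  proof -
    obtain y where "y \<in> D" "y \<in> ball x e" using D[of "ball x e"] e centre_in_ball[of x e] by blast
    moreover then obtain i where "d i = y"
      unfolding d_def using from_nat_into_surj[OF \<open>countable D\<close>] by blast
    ultimately show ?thesis by (auto intro!: exI[of _ i] simp: dist_commute)
  qed
  \<comment> \<open>Contrapositive of the countable-union lemma: balls of any radius around the
    dense points cover the space, so some pair of pieces inherits inseparability.\<close>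
  have refine: "\<exists>i j. \<not> sep (S \<inter> cball (d i) e) (T \<inter> cball (d j) e)"
    if "\<not> sep S T" "e > 0" for S T e
  proof (rule ccontr)
    assume "\<not> ?thesis"
    then have "\<And>i j. \<exists>B\<in>sets borel. f ` (S \<inter> cball (d i) e) \<subseteq> B \<and> f ` (T \<inter> cball (d j) e) \<inter> B = {}"
      by (simp add: sep_def)
    from borel_separated_UN[OF this]
    have "sep (\<Union>i. S \<inter> cball (d i) e) (\<Union>j. T \<inter> cball (d j) e)"
      by (simp only: sep_def image_UN)
    moreover have "(\<Union>i. R \<inter> cball (d i) e) = R" for R
      using cover[OF \<open>e > 0\<close>] by blast
    ultimately show False using that by simp
  qed
  define ok where "ok ST \<longleftrightarrow> closed (fst ST) \<and> closed (snd ST) \<and> \<not> sep (fst ST) (snd ST)" for ST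
  define small where "small n R \<longleftrightarrow> (\<exists>c. R \<subseteq> cball c ((1/2)^n))" for n :: nat and R :: "'a set"
  \<comment> \<open>The clause for \<open>n = 0\<close> pins the starting pair. Radii are shifted by
    one: stage \<open>Suc n\<close> lies in balls of radius \<open>(1/2)^n\<close>, while nothing is
    claimed about the size of stage 0.\<close>
  have "\<exists>F. \<forall>n. (ok (F n) \<and> (n = 0 \<longrightarrow> F n = (P, Q))) \<and>
      (fst (F (Suc n)) \<subseteq> fst (F n) \<and> snd (F (Suc n)) \<subseteq> snd (F n) \<and>
       small n (fst (F (Suc n))) \<and> small n (snd (F (Suc n))))"
  proof (rule dependent_nat_choice)
    show "\<exists>ST. ok ST \<and> (0 = (0::nat) \<longrightarrow> ST = (P, Q))"
      using assms nsep by (auto simp: ok_def)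
  next
    fix ST and n :: nat assume "ok ST \<and> (n = 0 \<longrightarrow> ST = (P, Q))"
    then have ST: "closed (fst ST)" "closed (snd ST)" "\<not> sep (fst ST) (snd ST)"
      by (auto simp: ok_def)
    obtain i j where "\<not> sep (fst ST \<inter> cball (d i) ((1/2)^n)) (snd ST \<inter> cball (d j) ((1/2)^n))"
      using refine[OF ST(3), of "(1/2)^n"] by auto
    then show "\<exists>ST'. (ok ST' \<and> (Suc n = 0 \<longrightarrow> ST' = (P, Q))) \<and>
       (fst ST' \<subseteq> fst ST \<and> snd ST' \<subseteq> snd ST \<and> small n (fst ST') \<and> small n (snd ST'))"
      using ST by (intro exI[of _ "(fst ST \<inter> cball (d i) ((1/2)^n), snd ST \<inter> cball (d j) ((1/2)^n))"])
        (auto simp: ok_def small_def)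
  qed
  then obtain F where F: "\<And>n. ok (F n)" "F 0 = (P, Q)"
    "\<And>n. fst (F (Suc n)) \<subseteq> fst (F n)" "\<And>n. snd (F (Suc n)) \<subseteq> snd (F n)"
    "\<And>n. small n (fst (F (Suc n)))" "\<And>n. small n (snd (F (Suc n)))" by metis
  have shrink: "\<exists>n. \<forall>x\<in>R n. \<forall>y\<in>R n. dist x y < e" if sm: "\<And>n. small n (R (Suc n))" and "e > 0" for R e
  proof -
    obtain n where n: "(1/2::real)^n < e/2" using real_arch_pow_inv[of "e/2" "1/2"] \<open>e > 0\<close> by auto
    obtain c where c: "R (Suc n) \<subseteq> cball c ((1/2)^n)" using sm by (auto simp: small_def)
    have "dist x y < e" if "x \<in> R (Suc n)" "y \<in> R (Suc n)" for x y
    proof -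
      have "dist c x \<le> (1/2)^n" "dist c y \<le> (1/2)^n" using c that by auto
      then show ?thesis using n dist_triangle3[of x y c] by linarith
    qed
    then show ?thesis by blast
  qed
  \<comment> \<open>An empty set is always separated, by \<open>{}\<close> if it is the first and by
    \<open>UNIV\<close> if it is the second.\<close>
  have ne: "fst (F n) \<noteq> {}" "snd (F n) \<noteq> {}" for n
    using F(1)[of n] by (auto simp: ok_def sep_def intro: bexI[of _ "{}"] bexI[of _ UNIV])
  have cl: "closed (fst (F n))" "closed (snd (F n))" for n
    using F(1)[of n] by (auto simp: ok_def)
  have point: "\<exists>a. \<forall>n. a \<in> R n"
    if "\<And>n. closed (R n)" "\<And>n. R n \<noteq> {}" "\<And>n. R (Suc n) \<subseteq> R n" "\<And>n. small n (R (Suc n))" for R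
  proof -
    have "m \<le> n \<Longrightarrow> R n \<subseteq> R m" for m n using lift_Suc_antimono_le[of R] that(3) by blast
    then show ?thesis using decreasing_closed_nest[of R] that(1,2) shrink[of R, OF that(4)] by metis
  qed
  obtain p where p: "\<And>n. p \<in> fst (F n)"
    using point[of "\<lambda>n. fst (F n)", OF _ ne(1) F(3) F(5)] cl by blast
  obtain q where q: "\<And>n. q \<in> snd (F n)"
    using point[of "\<lambda>n. snd (F n)", OF _ ne(2) F(4) F(6)] cl by blast
  have "f p \<noteq> f q" using p[of 0] q[of 0] disj F(2) by auto
  then obtain U V where UV: "open U" "open V" "f p \<in> U" "f q \<in> V" "U \<inter> V = {}"
    using hausdorff by metis
  have inside: "\<exists>n. \<forall>m\<ge>n. f ` R m \<subseteq> W"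
    if a: "\<And>n. a \<in> R n" and dec: "\<And>n. R (Suc n) \<subseteq> R n" and sm: "\<And>n. small n (R (Suc n))"
      and "open W" "f a \<in> W" for R a W
  proof -
    have "open (f -` W)" using cont \<open>open W\<close> by (simp add: open_vimage)
    then obtain e where "e > 0" "ball a e \<subseteq> f -` W"
      using \<open>f a \<in> W\<close> by (meson open_contains_ball vimageI)
    obtain n where "\<forall>x\<in>R n. \<forall>y\<in>R n. dist x y < e" using shrink[of R, OF sm \<open>e > 0\<close>] by blast
    have W: "f ` R n \<subseteq> W"
    proof (intro image_subsetI)
      fix x assume "x \<in> R n"
      with \<open>\<forall>x\<in>R n. \<forall>y\<in>R n. dist x y < e\<close> have "x \<in> ball a e" using a[of n] by simp
      then show "f x \<in> W" using \<open>ball a e \<subseteq> f -` W\<close> by blast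
    qed
    have "f ` R m \<subseteq> W" if "n \<le> m" for m
    proof -
      have "R m \<subseteq> R n" using dec that by (rule lift_Suc_antimono_le)
      then show ?thesis using W by blast
    qed
    then show ?thesis by blast
  qed
  have "\<exists>n. \<forall>m\<ge>n. f ` fst (F m) \<subseteq> U"
    by (rule inside[where a = p]) (use p F(3,5) UV in auto)
  then obtain n1 where n1: "\<forall>m\<ge>n1. f ` fst (F m) \<subseteq> U" by blast
  have "\<exists>n. \<forall>m\<ge>n. f ` snd (F m) \<subseteq> V"
    by (rule inside[where a = q]) (use q F(4,6) UV in auto)
  then obtain n2 where n2: "\<forall>m\<ge>n2. f ` snd (F m) \<subseteq> V" by blast
  \<comment> \<open>Late stages have images inside the disjoint open sets \<open>U\<close> and
    \<open>V\<close>, so \<open>U\<close> itself separates them, against the construction.\<close>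
  have "sep (fst (F (max n1 n2))) (snd (F (max n1 n2)))"
    unfolding sep_def
    using n1[rule_format, of "max n1 n2"] n2[rule_format, of "max n1 n2"] UV
    by (intro bexI[of _ U]) auto
  then show False using F(1)[of "max n1 n2"] by (simp add: ok_def)
qed

text \<open>Preimages of Borel sets form a sigma-algebra, so open sets suffice. An open
  \<open>U\<close> is the union of the closed sets \<open>C i\<close> of points at distance at least
  \<open>1 / (i + 1)\<close> from its complement. By injectivity the images of \<open>C i\<close>
  and of the complement are disjoint; the union of the separating Borel sets has preimage exactly
  \<open>U\<close>.\<close>

lemma borel_vimage_inj_continuous:
  fixes f :: "'a::{complete_space, second_countable_topology} \<Rightarrow> 'b::t2_space"
  assumes cont: "continuous_on UNIV f" and "inj f" and "A \<in> sets borel"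
  shows "\<exists>B\<in>sets borel. A = f -` B"
proof -
  define S where "S = (\<lambda>B. f -` B) ` sets (borel :: 'b measure)"
  have "sigma_algebra UNIV S"
    using sets.sigma_algebra_axioms[of "vimage_algebra UNIV f borel"]
      sets_vimage_algebra2[of f UNIV borel]
    by (simp add: S_def image_def Collect_conj_eq Setcompr_eq_image)
  have opn: "U \<in> S" if "open U" for U
  proof -
    define C where "C i = (\<Inter>y\<in>-U. {x. inverse (real (Suc i)) \<le> dist x y})" for i
    have C: "closed (C i)" for i
      unfolding C_def by (intro closed_INT ballI closed_Collect_le continuous_intros)
    have CU: "U = (\<Union>i. C i)"
    proof (intro equalityI subsetI)
      fix x assume "x \<in> U"
      then obtain e where "e > 0" "ball x e \<subseteq> U" using \<open>open U\<close> by (auto simp: open_contains_ball)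
      moreover obtain i where "inverse (real (Suc i)) < e" using reals_Archimedean[OF \<open>e > 0\<close>] by blast
      ultimately have "inverse (real (Suc i)) \<le> dist x y" if "y \<notin> U" for y
        using that by (meson in_mono le_less_linear less_trans mem_ball)
      then have "x \<in> C i" by (simp add: C_def)
      then show "x \<in> (\<Union>i. C i)" by blast
    next
      fix x assume "x \<in> (\<Union>i. C i)"
      then obtain i where "x \<in> C i" by blast
      then have "x \<notin> U \<Longrightarrow> inverse (real (Suc i)) \<le> dist x x" unfolding C_def by blast
      then show "x \<in> U" using inverse_positive_iff_positive[of "real (Suc i)"] by fastforce
    qed
    have "\<exists>B\<in>sets borel. f ` C i \<subseteq> B \<and> f ` (- U) \<inter> B = {}" for i
    proof (rule lusin_separation[OF cont C])
      show "closed (- U)" using \<open>open U\<close> by (simp add: closed_Compl)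
      have "C i \<inter> - U = {}" using CU by blast
      then show "f ` C i \<inter> f ` (- U) = {}" using \<open>inj f\<close> by (simp add: image_Int[symmetric])
    qed
    then obtain B where B: "\<And>i. B i \<in> sets borel" "\<And>i. f ` C i \<subseteq> B i" "\<And>i. f ` (- U) \<inter> B i = {}"
      by metis
    have "U = f -` (\<Union>i. B i)" using B CU by blast
    then show ?thesis unfolding S_def using B(1) by blast
  qed
  have "sigma_sets UNIV {U. open U} \<subseteq> S"
    using opn \<open>sigma_algebra UNIV S\<close> by (intro sigma_algebra.sigma_sets_subset) auto
  then show ?thesis using \<open>A \<in> sets borel\<close> by (auto simp: S_def sets_borel)
qed

text \<open>If \<open>A\<close> is the preimage of \<open>B\<close>, its image is \<open>B\<close>
  cut with the range. The value \<open>x0\<close> makes the inverse total and adds at most the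
  complement of the range to a preimage.\<close>

lemma inj_continuous_borel_inverse:
  fixes f :: "'a::{complete_space, second_countable_topology} \<Rightarrow> 'b::t2_space"
  assumes cont: "continuous_on UNIV f" and "inj f" and ran: "range f \<in> sets borel"
  shows borel_image_inj_continuous: "\<And>A. A \<in> sets borel \<Longrightarrow> f ` A \<in> sets borel"
    and borel_measurable_inv_into_range:
      "(\<lambda>y. if y \<in> range f then inv f y else x0) \<in> borel_measurable borel"
proof -
  show im: "f ` A \<in> sets borel" if A: "A \<in> sets borel" for A
  proof -
    obtain B where "B \<in> sets borel" "A = f -` B"
      using borel_vimage_inj_continuous[OF assms(1,2) A] by blast
    moreover then have "f ` A = B \<inter> range f" by auto
    ultimately show ?thesis using ran by auto
  qed
  have "(\<lambda>y. if y \<in> range f then inv f y else x0) -` A =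
      f ` A \<union> (if x0 \<in> A then - range f else {})" for A
    using \<open>inj f\<close> by (auto simp: image_iff split: if_splits)
  then show "(\<lambda>y. if y \<in> range f then inv f y else x0) \<in> borel_measurable borel"
    using im ran by (intro measurableI) (auto simp: borel_comp)
qed

text \<open>Turns the set function into an image measure, so that products and integrals can be
  computed on \<open>M\<close>. The two inversion laws for \<open>g\<close> later let linear
  identities pass through it.\<close>

lemma measure_on_subspace_eq_distr:
  fixes \<iota> :: "'a::{complete_space, second_countable_topology} \<Rightarrow> 'b::t2_space"
  assumes cont: "continuous_on UNIV \<iota>" and "inj \<iota>" and M: "prob_space M" "sets M = sets borel"
    and full: "emeasure M (range \<iota>) = 1"
  shows "\<exists>g\<in>borel_measurable M. measure_on_subspace \<iota> M = distr M borel g \<and>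
    (\<forall>x. g (\<iota> x) = x) \<and> (AE y in M. \<iota> (g y) = y)"
proof -
  interpret prob_space M by fact
  \<comment> \<open>A set that is not measurable would have \<open>emeasure\<close> 0 instead of
    1.\<close>
  have ran: "range \<iota> \<in> sets borel"
    using full emeasure_notin_sets[of "range \<iota>" M] M by fastforce
  define g where "g y = (if y \<in> range \<iota> then inv \<iota> y else undefined)" for y
  have g: "g \<in> borel_measurable M"
    using borel_measurable_inv_into_range[OF cont \<open>inj \<iota>\<close> ran] M
    unfolding g_def by (simp cong: measurable_cong_sets)
  have spM: "space M = UNIV" using sets_eq_imp_space_eq[OF M(2)] by simp
  have AE: "AE y in M. y \<in> range \<iota>"
    using full ran M(2) AE_in_set_eq_1[of "range \<iota>"] by (simp add: measure_def)
  have em: "emeasure (distr M borel g) A = emeasure M (\<iota> ` A)" if A: "A \<in> sets borel" for A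
  proof -
    have "emeasure (distr M borel g) A = emeasure M (g -` A)"
      using g A spM by (simp add: emeasure_distr)
    also have "\<dots> = emeasure M (\<iota> ` A)"
    proof (rule emeasure_eq_AE, goal_cases)
      case 1
      show ?case
        using AE
      proof (rule AE_mp, intro AE_I2 impI)
        fix y assume "y \<in> range \<iota>"
        then show "(y \<in> g -` A) = (y \<in> \<iota> ` A)"
          using \<open>inj \<iota>\<close> by (auto simp: g_def image_iff inj_eq)
      qed
    next
      case 2
      show ?case using measurable_sets[OF g A] spM by simp
    next
      case 3
      show ?case using borel_image_inj_continuous[OF cont \<open>inj \<iota>\<close> ran A] M by simp
    qed
    finally show ?thesis .
  qed
  have "distr M borel g = measure_of UNIV (sets borel) (emeasure (distr M borel g))"
    using measure_of_of_measure[of "distr M borel g"] by simp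
  also have "\<dots> = measure_on_subspace \<iota> M"
    unfolding measure_on_subspace_def using sets.sigma_sets_eq[of "borel :: 'a measure"]
    by (intro measure_of_eq) (auto simp: em)
  finally have "measure_on_subspace \<iota> M = distr M borel g" by simp
  moreover have "AE y in M. \<iota> (g y) = y"
    using AE by eventually_elim (auto simp: g_def f_inv_into_f)
  moreover have "g (\<iota> x) = x" for x
    using \<open>inj \<iota>\<close> by (simp add: g_def)
  ultimately show ?thesis using g by blast
qed

section \<open>Uniqueness of measures with equal characteristic functionals\<close>

text \<open>Levy's theorem concerns probability measures. The value of \<open>char\<close> at 0 is
  the total mass, so both measures can be scaled by the same constant; mass 0 is treated
  apart.\<close>

lemma finite_measure_char_unique:
  fixes M N :: "real measure"
  assumes "finite_measure M" "finite_measure N" and sets: "sets M = sets borel" "sets N = sets borel"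
    and char: "char M = char N"
  shows "M = N"
proof -
  interpret M: finite_measure M by fact
  interpret N: finite_measure N by fact
  have sp: "space M = UNIV" "space N = UNIV" using sets sets_eq_imp_space_eq[of _ borel] by auto
  have ch0: "char L 0 = of_real (measure L UNIV)" if "finite_measure L" "space L = UNIV" for L
    using that by (simp add: char_def scaleR_conv_of_real)
  have mass: "measure M UNIV = measure N UNIV"
    using ch0[of M] ch0[of N] assms sp by simp
  define m where "m = measure M UNIV"
  show ?thesis
  proof (cases "m = 0")
    case True
    have "emeasure M A = emeasure N A" for A
    proof -
      have "measure M A \<le> measure M UNIV" "measure N A \<le> measure N UNIV"
        using M.bounded_measure[of A] N.bounded_measure[of A] sp by auto
      then have "measure M A = 0" "measure N A = 0"
        using True mass by (simp_all add: m_def measure_le_0_iff)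
      then show ?thesis by (simp add: M.emeasure_eq_measure N.emeasure_eq_measure)
    qed
    then show ?thesis using sets by (intro measure_eqI) auto
  next
    case False
    then have "m > 0" by (simp add: m_def zero_less_measure_iff)
    define sc where "sc L = density L (\<lambda>_. ennreal (1 / m))" for L :: "real measure"
    have em: "emeasure (sc L) A = ennreal (1 / m) * emeasure L A" if "A \<in> sets L" for L A
      using that by (simp add: sc_def emeasure_density_const)
    have rd: "real_distribution (sc L)"
      if "finite_measure L" "sets L = sets borel" "measure L UNIV = m" for L
    proof -
      have "space L = UNIV" using that(2) sets_eq_imp_space_eq[of _ borel] by auto
      moreover have "emeasure L UNIV = ennreal m"
        using that(1,3) finite_measure.emeasure_eq_measure[of L] by metis
      ultimately have "emeasure (sc L) (space (sc L)) = 1"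
        using em[of UNIV L] that(2) \<open>m > 0\<close> by (simp add: sc_def ennreal_mult[symmetric])
      then show ?thesis using that(2)
        by (intro real_distribution.intro prob_spaceI real_distribution_axioms.intro) (auto simp: sc_def)
    qed
    have charsc: "char (sc L) t = (1 / m) *\<^sub>R char L t" if L [measurable_cong]: "sets L = sets borel" for L t
      unfolding char_def sc_def
    proof (subst integral_density)
      show "(\<lambda>x. iexp (t * x)) \<in> borel_measurable L" by measurable
    qed (use \<open>m > 0\<close> in simp_all)
    have "sc M = sc N"
      using rd assms mass charsc[OF sets(1)] charsc[OF sets(2)]
      by (intro Levy_uniqueness ext) (auto simp: m_def)
    have "emeasure M A = emeasure N A" if A: "A \<in> sets M" for A
    proof -
      have "emeasure (sc M) A = emeasure (sc N) A" by (simp add: \<open>sc M = sc N\<close>)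
      then have "ennreal (1 / m) * emeasure M A = ennreal (1 / m) * emeasure N A"
        using em[of A M] em[of A N] A sets by simp
      then show ?thesis using \<open>m > 0\<close> by (simp add: ennreal_mult_cancel_left)
    qed
    then show ?thesis using sets by (intro measure_eqI) auto
  qed
qed

text \<open>The norm is a supremum over countably many functionals: a closed ball is the
  intersection of half-spaces with normals in a dense set. By separability every open set is a
  countable union of such balls.\<close>

lemma sets_borel_subset_sigma_inner:
  fixes G :: "'a::{real_inner, second_countable_topology} set set"
  assumes G: "\<And>k A. A \<in> sets borel \<Longrightarrow> {u. u \<bullet> k \<in> A} \<in> G"
  shows "sets borel \<subseteq> sigma_sets UNIV G"
proof -
  define S where "S = sigma UNIV G"
  have S: "space S = UNIV" "sets S = sigma_sets UNIV G" by (simp_all add: S_def space_measure_of_conv)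
  have meas [measurable]: "(\<lambda>u. u \<bullet> k) \<in> borel_measurable S" for k
    using G by (intro measurableI) (auto simp: S vimage_def)
  obtain D :: "'a set" where "countable D" and D: "\<And>X. open X \<Longrightarrow> X \<noteq> {} \<Longrightarrow> \<exists>d\<in>D. d \<in> X"
    using countable_dense_exists by blast
  have cb: "cball x r \<in> sets S" if "r \<ge> 0" for x r
  proof -
    have "(\<forall>k\<in>D. (u - x) \<bullet> k \<le> r * norm k) \<longleftrightarrow> norm (u - x) \<le> r" for u
    proof
      assume *: "\<forall>k\<in>D. (u - x) \<bullet> k \<le> r * norm k"
      \<comment> \<open>Failure of the inequality is an open condition on \<open>k\<close>, so it
        would already occur in \<open>D\<close>. Afterwards the direction \<open>k = u - x\<close>
        may be tested.\<close>
      have "open {k. r * norm k < (u - x) \<bullet> k}"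
        by (intro open_Collect_less continuous_intros)
      then have "{k. r * norm k < (u - x) \<bullet> k} = {}"
        using D[of "{k. r * norm k < (u - x) \<bullet> k}"] * by force
      then have "(u - x) \<bullet> (u - x) \<le> r * norm (u - x)" by (force simp: not_less)
      then show "norm (u - x) \<le> r" using that
        by (cases "norm (u - x) = 0") (auto simp: dot_square_norm power2_eq_square)
    next
      assume *: "norm (u - x) \<le> r"
      show "\<forall>k\<in>D. (u - x) \<bullet> k \<le> r * norm k"
      proof
        fix k
        have "(u - x) \<bullet> k \<le> norm (u - x) * norm k" by (rule norm_cauchy_schwarz)
        also have "\<dots> \<le> r * norm k" using * by (intro mult_right_mono) auto
        finally show "(u - x) \<bullet> k \<le> r * norm k" .
      qed
    qed
    then have "cball x r = {u\<in>space S. \<forall>k\<in>D. u \<bullet> k - x \<bullet> k \<le> r * norm k}"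
      by (auto simp: S dist_norm norm_minus_commute inner_diff_left)
    also have "\<dots> \<in> sets S"
      using \<open>countable D\<close> by measurable
    finally show ?thesis .
  qed
  have "U \<in> sets S" if U: "open U" for U
  proof -
    define I where "I = {(d, n). d \<in> D \<and> cball d (inverse (real (Suc n))) \<subseteq> U}"
    have "U \<subseteq> (\<Union>(d, n)\<in>I. cball d (inverse (real (Suc n))))"
    proof
      fix x assume "x \<in> U"
      then obtain e where "e > 0" and e: "ball x e \<subseteq> U" using U by (meson open_contains_ball)
      obtain n where n: "inverse (real (Suc n)) < e / 2" using reals_Archimedean[of "e / 2"] \<open>e > 0\<close> by auto
      obtain d where d: "d \<in> D" "dist x d < inverse (real (Suc n))"
        using D[of "ball x (inverse (real (Suc n)))"] by force
      have "y \<in> U" if "dist d y \<le> inverse (real (Suc n))" for y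
      proof -
        have "dist x y < e" using dist_triangle[of x y d] d(2) n that by linarith
        then show ?thesis using e by auto
      qed
      then have "(d, n) \<in> I" using d by (auto simp: I_def)
      then show "x \<in> (\<Union>(d, n)\<in>I. cball d (inverse (real (Suc n))))"
        using d by (force simp: dist_commute simp del: of_nat_Suc)
    qed
    then have "U = (\<Union>(d, n)\<in>I. cball d (inverse (real (Suc n))))" by (auto simp: I_def)
    moreover have "countable I"
      by (rule countable_subset[of _ "D \<times> UNIV"]) (use \<open>countable D\<close> in \<open>auto simp: I_def\<close>)
    moreover have "(\<Union>(d, n)\<in>I. cball d (inverse (real (Suc n)))) \<in> sets S"
      using \<open>countable I\<close> by (intro sets.countable_UN') (auto intro!: cb split: prod.splits)
    ultimately show ?thesis by simp
  qed
  then show ?thesis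
    using sets.sigma_sets_subset[of "{U. open U}" S] S by (auto simp: sets_borel)
qed

text \<open>The one-dimensional uniqueness theorem applies to positive measures only, hence the weight:
  the cases \<open>c = 0, 1, -\<i>\<close> recover the real and imaginary parts of the weighted integrals of
  \<open>iexp (u \<bullet> h)\<close>.\<close>

lemma distr_weighted_eq:
  fixes M N :: "'a::{real_inner, second_countable_topology} measure"
  assumes fin: "finite_measure M" "finite_measure N" and sets: "sets M = sets borel" "sets N = sets borel"
    and E: "E \<in> sets borel"
    and char: "\<And>h. (CLINT u|M. indicator E u *\<^sub>R iexp (u \<bullet> h)) = (CLINT u|N. indicator E u *\<^sub>R iexp (u \<bullet> h))"
    and "cmod c \<le> 1" and A: "A \<in> sets borel"
  shows "(LINT u|M. indicator (E \<inter> {u. u \<bullet> k \<in> A}) u * (1 + Re (c * iexp (u \<bullet> h)))) =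
         (LINT u|N. indicator (E \<inter> {u. u \<bullet> k \<in> A}) u * (1 + Re (c * iexp (u \<bullet> h))))"
proof -
  define w where "w u = indicator E u * (1 + Re (c * iexp (u \<bullet> h)))" for u
  have [measurable]: "w \<in> borel_measurable borel"
    unfolding w_def using E by measurable
  have Re: "\<bar>Re (c * iexp (u \<bullet> h))\<bar> \<le> 1" for u
    using abs_Re_le_cmod[of "c * iexp (u \<bullet> h)"] \<open>cmod c \<le> 1\<close> by (simp add: norm_mult)
  have w: "0 \<le> w u" "w u \<le> 2" for u
    using Re[of u] by (auto simp: w_def indicator_def abs_le_iff)
  define D where "D L = distr (density L (\<lambda>u. ennreal (w u))) borel (\<lambda>u. u \<bullet> k)" for L :: "'a measure"
  \<comment> \<open>Writing a real part as half of \<open>z + cnj z\<close> expands the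
    characteristic function of the weighted law into integrals over \<open>E\<close> at three
    frequencies, each of which \<open>char\<close> equates for \<open>M\<close> and
    \<open>N\<close>.\<close>
  have *: "finite_measure (D L) \<and> char (D L) t =
        (CLINT u|L. indicator E u *\<^sub>R iexp (u \<bullet> (t *\<^sub>R k)))
      + c / 2 * (CLINT u|L. indicator E u *\<^sub>R iexp (u \<bullet> (t *\<^sub>R k + h)))
      + cnj c / 2 * (CLINT u|L. indicator E u *\<^sub>R iexp (u \<bullet> (t *\<^sub>R k - h))) \<and>
      measure (D L) A = (LINT u|L. indicator (E \<inter> {u. u \<bullet> k \<in> A}) u * (1 + Re (c * iexp (u \<bullet> h))))"
    if "finite_measure L" and L [measurable_cong]: "sets L = sets borel" for L t
  proof -
    interpret finite_measure L by fact
    have sp: "space L = UNIV" using L sets_eq_imp_space_eq[of _ borel] by auto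
    have iw: "integrable L w"
      using w by (intro integrable_const_bound[of _ 2]) auto
    have "emeasure (density L w) (space L) < \<infinity>"
      using nn_integral_eq_integral[OF iw] w by (simp add: emeasure_density cong: nn_integral_cong)
    then have "finite_measure (density L w)" by (intro finite_measureI) auto
    then have fin: "finite_measure (D L)"
      unfolding D_def by (rule finite_measure.finite_measure_distr) simp
    have [measurable]: "E \<in> sets L" "A \<in> sets borel" using E L A by auto
    have int: "integrable L (\<lambda>u. indicator E u *\<^sub>R iexp (u \<bullet> h))" for h
      by (intro integrable_const_bound[of _ 1]) (auto simp: indicator_def)
    have lin: "(CLINT u|L. f u + a * g u + b * g' u) = (CLINT u|L. f u) + a * (CLINT u|L. g u) + b * (CLINT u|L. g' u)"
      if "integrable L f" "integrable L g" "integrable L g'" for f g g' a b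
      using that by simp
    have "char (D L) t = (CLINT u|L. w u *\<^sub>R iexp (t * (u \<bullet> k)))"
      unfolding char_def D_def using w by (simp add: integral_distr integral_density)
    also have "\<dots> = (CLINT u|L. indicator E u *\<^sub>R iexp (u \<bullet> (t *\<^sub>R k))
      + c / 2 * (indicator E u *\<^sub>R iexp (u \<bullet> (t *\<^sub>R k + h)))
      + cnj c / 2 * (indicator E u *\<^sub>R iexp (u \<bullet> (t *\<^sub>R k - h))))"
    proof (rule Bochner_Integration.integral_cong)
      fix u
      have e: "iexp (u \<bullet> (t *\<^sub>R k + h)) = iexp (t * (u \<bullet> k)) * iexp (u \<bullet> h)"
        "iexp (u \<bullet> (t *\<^sub>R k - h)) = iexp (t * (u \<bullet> k)) * cnj (iexp (u \<bullet> h))"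
        by (simp_all add: inner_add_right inner_diff_right exp_add[symmetric] exp_cnj algebra_simps)
      have "complex_of_real (1 + Re (c * iexp (u \<bullet> h))) = 1 + c / 2 * iexp (u \<bullet> h) + cnj c / 2 * cnj (iexp (u \<bullet> h))"
        using complex_add_cnj[of "c * iexp (u \<bullet> h)"] by (simp add: field_simps)
      then show "w u *\<^sub>R iexp (t * (u \<bullet> k)) = indicator E u *\<^sub>R iexp (u \<bullet> (t *\<^sub>R k))
      + c / 2 * (indicator E u *\<^sub>R iexp (u \<bullet> (t *\<^sub>R k + h)))
      + cnj c / 2 * (indicator E u *\<^sub>R iexp (u \<bullet> (t *\<^sub>R k - h)))"
        unfolding e w_def scaleR_conv_of_real of_real_mult by (simp only:) (simp add: algebra_simps)
    qed simp
    also have "\<dots> = (CLINT u|L. indicator E u *\<^sub>R iexp (u \<bullet> (t *\<^sub>R k)))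
      + c / 2 * (CLINT u|L. indicator E u *\<^sub>R iexp (u \<bullet> (t *\<^sub>R k + h)))
      + cnj c / 2 * (CLINT u|L. indicator E u *\<^sub>R iexp (u \<bullet> (t *\<^sub>R k - h)))"
      by (rule lin) (rule int)+
    finally have ch: "char (D L) t =
        (CLINT u|L. indicator E u *\<^sub>R iexp (u \<bullet> (t *\<^sub>R k)))
      + c / 2 * (CLINT u|L. indicator E u *\<^sub>R iexp (u \<bullet> (t *\<^sub>R k + h)))
      + cnj c / 2 * (CLINT u|L. indicator E u *\<^sub>R iexp (u \<bullet> (t *\<^sub>R k - h)))" .
    have "measure (D L) A = measure (density L w) {u. u \<bullet> k \<in> A}"
      unfolding D_def using sp by (subst measure_distr) (auto simp: vimage_def)
    also have "\<dots> = (LINT u|density L w. indicator {u. u \<bullet> k \<in> A} u)"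
      using sp by simp
    also have "\<dots> = (LINT u|L. w u * indicator {u. u \<bullet> k \<in> A} u)"
      using w by (subst integral_density) auto
    also have "\<dots> = (LINT u|L. indicator (E \<inter> {u. u \<bullet> k \<in> A}) u * (1 + Re (c * iexp (u \<bullet> h))))"
      by (rule Bochner_Integration.integral_cong) (auto simp: w_def indicator_def)
    finally show ?thesis using fin ch by blast
  qed
  note DM = *[OF fin(1) sets(1)] and DN = *[OF fin(2) sets(2)]
  have "D M = D N"
  proof (rule finite_measure_char_unique)
    show "char (D M) = char (D N)"
      unfolding fun_eq_iff DM[THEN conjunct2, THEN conjunct1] DN[THEN conjunct2, THEN conjunct1] char
      by (intro allI refl)
  qed (use DM DN in \<open>simp_all add: D_def\<close>)
  then show ?thesis
    using DM DN by metis
qed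

lemma cylinder_in_borel:
  fixes xs :: "('a::{real_inner, second_countable_topology} \<times> real set) list"
  assumes "\<forall>(k, A)\<in>set xs. A \<in> sets borel"
  shows "{u. \<forall>(k, A)\<in>set xs. u \<bullet> k \<in> A} \<in> sets borel"
  using assms
proof (induction xs)
  case (Cons x xs)
  have "(\<lambda>u. u \<bullet> fst x) -` snd x \<inter> space borel \<in> sets borel"
    using Cons.prems by (intro measurable_sets[of _ _ borel]) auto
  moreover have "{u. \<forall>(k, A)\<in>set (x # xs). u \<bullet> k \<in> A} =
      ((\<lambda>u. u \<bullet> fst x) -` snd x \<inter> space borel) \<inter> {u. \<forall>(k, A)\<in>set xs. u \<bullet> k \<in> A}"
    by auto
  ultimately show ?case using Cons by auto
qed simp

text \<open>Induction on the constraints reduces the several-dimensional uniqueness to the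
  one-dimensional one. The phase with arbitrary \<open>h\<close> must stay in the claim: adding a
  constraint in direction \<open>k\<close> consumes the equality at \<open>t *\<^sub>R k\<close> and
  \<open>t *\<^sub>R k\<close> plus or minus \<open>h\<close>.\<close>

lemma iexp_integral_cylinder_eq:
  fixes M N :: "'a::{real_inner, second_countable_topology} measure"
  assumes fin: "finite_measure M" "finite_measure N" and sets: "sets M = sets borel" "sets N = sets borel"
    and char: "\<And>h. (CLINT u|M. iexp (u \<bullet> h)) = (CLINT u|N. iexp (u \<bullet> h))"
    and "\<And>k A. (k, A) \<in> set xs \<Longrightarrow> A \<in> sets borel"
  shows "(CLINT u|M. indicator {u. \<forall>(k, A)\<in>set xs. u \<bullet> k \<in> A} u *\<^sub>R iexp (u \<bullet> h)) =
         (CLINT u|N. indicator {u. \<forall>(k, A)\<in>set xs. u \<bullet> k \<in> A} u *\<^sub>R iexp (u \<bullet> h))"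
  using assms(6)
proof (induction xs arbitrary: h)
  case Nil
  then show ?case using char by simp
next
  case (Cons x xs)
  obtain k A where x: "x = (k, A)" by force
  then have A: "A \<in> sets borel" using Cons.prems by auto
  define E where "E = {u. \<forall>(k, A)\<in>set xs. u \<bullet> k \<in> A}"
  define F where "F = E \<inter> {u. u \<bullet> k \<in> A}"
  have E: "E \<in> sets borel"
    unfolding E_def using Cons.prems by (intro cylinder_in_borel) auto
  have "(\<lambda>u. u \<bullet> k) -` A \<inter> space borel \<in> sets borel"
    using A by (intro measurable_sets[of _ _ borel]) auto
  then have F: "F \<in> sets borel" using E by (simp add: F_def vimage_def)
  have FE: "F = {u. \<forall>(k, A)\<in>set (x # xs). u \<bullet> k \<in> A}" by (auto simp: F_def E_def x)
  have IH: "(CLINT u|M. indicator E u *\<^sub>R iexp (u \<bullet> h)) = (CLINT u|N. indicator E u *\<^sub>R iexp (u \<bullet> h))" for h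
    unfolding E_def using Cons.prems by (intro Cons.IH) auto
  have w: "(LINT u|M. indicator F u * (1 + Re (c * iexp (u \<bullet> h)))) =
      (LINT u|N. indicator F u * (1 + Re (c * iexp (u \<bullet> h))))" if "cmod c \<le> 1" for c
    unfolding F_def by (rule distr_weighted_eq[OF fin sets E IH that A])
  have dec: "integrable L (\<lambda>u. indicator F u *\<^sub>R iexp (u \<bullet> h))"
      "(LINT u|L. indicator F u * (1 + Re (c * iexp (u \<bullet> h)))) =
       (LINT u|L. indicator F u) + Re (c * (CLINT u|L. indicator F u *\<^sub>R iexp (u \<bullet> h)))"
    if "finite_measure L" and L [measurable_cong]: "sets L = sets borel" for L c
  proof -
    interpret finite_measure L by fact
    have [measurable]: "F \<in> sets L" using F L by simp
    show int: "integrable L (\<lambda>u. indicator F u *\<^sub>R iexp (u \<bullet> h))"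
      by (intro integrable_const_bound[of _ 1]) (auto simp: indicator_def)
    have int1: "integrable L (\<lambda>u. indicator F u :: real)"
      by (intro integrable_const_bound[of _ 1]) (auto simp: indicator_def)
    have "(LINT u|L. indicator F u * (1 + Re (c * iexp (u \<bullet> h)))) =
        (LINT u|L. indicator F u + Re (c * (indicator F u *\<^sub>R iexp (u \<bullet> h))))"
      by (rule Bochner_Integration.integral_cong) (auto simp: indicator_def)
    also have "\<dots> = (LINT u|L. indicator F u) + (LINT u|L. Re (c * (indicator F u *\<^sub>R iexp (u \<bullet> h))))"
      by (intro Bochner_Integration.integral_add int1 integrable_Re integrable_mult_right int)
    also have "(LINT u|L. Re (c * (indicator F u *\<^sub>R iexp (u \<bullet> h)))) =
        Re (c * (CLINT u|L. indicator F u *\<^sub>R iexp (u \<bullet> h)))"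
      by (simp only: integral_Re[OF integrable_mult_right[OF int]] integral_mult_right_zero)
    finally show "(LINT u|L. indicator F u * (1 + Re (c * iexp (u \<bullet> h)))) =
       (LINT u|L. indicator F u) + Re (c * (CLINT u|L. indicator F u *\<^sub>R iexp (u \<bullet> h)))" .
  qed
  show ?case
    unfolding FE[symmetric]
    using w[of 0] w[of 1] w[of "-\<i>"]
    unfolding dec(2)[OF fin(1) sets(1)] dec(2)[OF fin(2) sets(2)]
    by (intro complex_eqI) auto
qed

text \<open>Cylinder sets are an intersection-stable generator of the Borel sets, and the cylinder
  identity at frequency 0 is the equality of their masses.\<close>

theorem finite_measure_char_functional_unique:
  fixes M N :: "'a::{real_inner, second_countable_topology} measure"
  assumes fin: "finite_measure M" "finite_measure N" and sets: "sets M = sets borel" "sets N = sets borel"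
    and char: "\<And>h. (CLINT u|M. iexp (u \<bullet> h)) = (CLINT u|N. iexp (u \<bullet> h))"
  shows "M = N"
proof -
  interpret M: finite_measure M by fact
  interpret N: finite_measure N by fact
  define G where "G = {{u::'a. \<forall>(k, A)\<in>set xs. u \<bullet> k \<in> A} |xs. \<forall>(k, A)\<in>set xs. A \<in> sets borel}"
  have sp: "space M = UNIV" "space N = UNIV" using sets sets_eq_imp_space_eq[of _ borel] by auto
  have "sets borel = sigma_sets UNIV G"
  proof
    show "sets borel \<subseteq> sigma_sets UNIV G"
    proof (rule sets_borel_subset_sigma_inner)
      fix k :: 'a and A :: "real set" assume "A \<in> sets borel"
      then show "{u. u \<bullet> k \<in> A} \<in> G" unfolding G_def by (intro CollectI exI[of _ "[(k, A)]"]) auto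
    qed
    show "sigma_sets UNIV G \<subseteq> sets borel"
      using cylinder_in_borel sets.sigma_sets_subset[of G borel] by (auto simp: G_def)
  qed
  moreover have "Int_stable G"
  proof (rule Int_stableI)
    fix a b assume "a \<in> G" "b \<in> G"
    then obtain xs ys where "a = {u. \<forall>(k, A)\<in>set xs. u \<bullet> k \<in> A}" "b = {u. \<forall>(k, A)\<in>set ys. u \<bullet> k \<in> A}"
      "\<forall>(k, A)\<in>set xs. A \<in> sets borel" "\<forall>(k, A)\<in>set ys. A \<in> sets borel"
      by (auto simp: G_def)
    then show "a \<inter> b \<in> G"
      unfolding G_def by (intro CollectI exI[of _ "xs @ ys"]) auto
  qed
  moreover have "UNIV \<in> G" unfolding G_def by (intro CollectI exI[of _ "[]"]) auto
  moreover have "emeasure M a = emeasure N a" if a: "a \<in> G" for a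
  proof -
    obtain xs where xs: "a = {u. \<forall>(k, A)\<in>set xs. u \<bullet> k \<in> A}" "\<forall>(k, A)\<in>set xs. A \<in> sets borel"
      using a by (auto simp: G_def)
    then have "a \<in> sets M" "a \<in> sets N" using cylinder_in_borel[OF xs(2)] sets by simp_all
    moreover have "(CLINT u|M. indicator a u *\<^sub>R iexp (u \<bullet> 0)) = (CLINT u|N. indicator a u *\<^sub>R iexp (u \<bullet> 0))"
      unfolding xs(1) using xs(2) by (intro iexp_integral_cylinder_eq[OF fin sets char]) auto
    ultimately have "measure M a = measure N a"
      using sp by (simp add: scaleR_conv_of_real)
    then show ?thesis by (simp add: M.emeasure_eq_measure N.emeasure_eq_measure)
  qed
  ultimately show ?thesis
    using sets by (intro measure_eqI_generator_eq[of G UNIV M N "\<lambda>_. UNIV"]) auto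
qed

section \<open>Rotation invariance of Gaussian measures\<close>

lemma char_normal_law:
  assumes "v \<ge> 0"
  shows "(CLINT x|normal_law 0 v. iexp x) = of_real (exp (- v / 2))"
proof (cases "v = 0")
  case True
  then show ?thesis by (simp add: normal_law_def integral_return)
next
  case False
  then have v: "v > 0" using assms by simp
  have "(CLINT x|normal_law 0 v. iexp x) = (CLINT x|lborel. normal_density 0 (sqrt v) x *\<^sub>R iexp x)"
    using False by (simp add: normal_law_def integral_density)
  also have "\<dots> = sqrt v *\<^sub>R (CLINT x|lborel. normal_density 0 (sqrt v) (0 + sqrt v * x) *\<^sub>R iexp (0 + sqrt v * x))"
    using v by (subst lborel_integral_real_affine[of "sqrt v" _ 0]) auto
  also have "\<dots> = (CLINT x|lborel. sqrt v *\<^sub>R (normal_density 0 (sqrt v) (0 + sqrt v * x) *\<^sub>R iexp (0 + sqrt v * x)))"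
    by (rule integral_scaleR_right[symmetric])
  also have "\<dots> = (CLINT x|lborel. std_normal_density x *\<^sub>R iexp (sqrt v * x))"
    using v by (intro Bochner_Integration.integral_cong)
      (auto simp: normal_density_def real_sqrt_mult power_mult_distrib scaleR_conv_of_real)
  also have "\<dots> = char std_normal_distribution (sqrt v)"
    by (simp add: char_def integral_density)
  also have "\<dots> = of_real (exp (- v / 2))"
    using v by (simp add: char_std_normal_distribution)
  finally show ?thesis .
qed

lemma char_gaussian_measure:
  assumes "gaussian_measure 0 Cov M"
  shows "(CLINT u|M. iexp (u \<bullet> h)) = of_real (exp (- (Cov h \<bullet> h) / 2))"
proof -
  have [measurable_cong]: "sets M = sets borel" using assms by (simp add: gaussian_measure_def)
  have "distr M borel (\<lambda>u. u \<bullet> h) = normal_law 0 (Cov h \<bullet> h)" "0 \<le> Cov h \<bullet> h"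
    using assms by (auto simp: gaussian_measure_def)
  moreover have "(CLINT u|M. iexp (u \<bullet> h)) = (CLINT x|distr M borel (\<lambda>u. u \<bullet> h). iexp x)"
    by (subst integral_distr) auto
  ultimately show ?thesis by (simp add: char_normal_law)
qed

text \<open>A rotation by 45 degrees up to a reflection. The matrix is symmetric, so in an inner
  product \<open>rot\<close> can be moved unchanged from one factor to the other.\<close>

definition rot :: "'a::real_vector \<times> 'a \<Rightarrow> 'a \<times> 'a" where
  "rot w = ((fst w + snd w) /\<^sub>R sqrt 2, (fst w - snd w) /\<^sub>R sqrt 2)"

lemma rot_measurable [measurable]:
  "(rot :: 'a::{real_normed_vector, second_countable_topology} \<times> 'a \<Rightarrow> _) \<in> borel_measurable borel"
  unfolding rot_def by (intro borel_measurable_continuous_onI continuous_intros)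

lemma sets_pair_borel:
  fixes M :: "'a::second_countable_topology measure"
  assumes "sets M = sets borel"
  shows "sets (M \<Otimes>\<^sub>M M) = sets borel"
  using sets_pair_measure_cong[OF assms assms] unfolding borel_prod .

text \<open>The product has characteristic functional \<open>exp (- (q h + q k) / 2)\<close>. Moving
  \<open>rot\<close> to the frequencies turns \<open>q h + q k\<close> into the sum in
  \<open>par\<close>, which is the same number by the parallelogram law.\<close>

lemma gaussian_rot_invariant:
  fixes M :: "'h::{real_inner, banach, second_countable_topology} measure"
  assumes G: "gaussian_measure 0 Cov M"
  shows "distr (M \<Otimes>\<^sub>M M) borel rot = M \<Otimes>\<^sub>M M"
proof -
  interpret prob_space M using G by (simp add: gaussian_measure_def)
  interpret P: pair_prob_space M M ..
  have sM [measurable_cong]: "sets M = sets borel" using G by (simp add: gaussian_measure_def)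
  note sP [measurable_cong] = sets_pair_borel[OF sM]
  define q where "q h = Cov h \<bullet> h" for h
  have lin: "linear Cov" and sym: "Cov h \<bullet> k = h \<bullet> Cov k" for h k
    using G by (auto simp: gaussian_measure_def bounded_linear.linear)
  have par: "q ((h + k) /\<^sub>R sqrt 2) + q ((h - k) /\<^sub>R sqrt 2) = q h + q k" for h k
    unfolding q_def
    by (simp add: linear_cmul[OF lin] linear_add[OF lin] linear_diff[OF lin]
        inner_add_left inner_add_right inner_diff_left inner_diff_right field_simps)
  have ch: "(CLINT w|M \<Otimes>\<^sub>M M. iexp (w \<bullet> (h, k))) = of_real (exp (- (q h + q k) / 2))" for h k
  proof -
    have int: "integrable (M \<Otimes>\<^sub>M M) (\<lambda>w. iexp (w \<bullet> (h, k)))"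
      by (intro P.integrable_const_bound[of _ 1]) auto
    have "(CLINT w|M \<Otimes>\<^sub>M M. iexp (w \<bullet> (h, k))) = (CLINT u|M. CLINT v|M. iexp ((u, v) \<bullet> (h, k)))"
      using P.integral_fst'[OF int] by simp
    also have "\<dots> = (CLINT u|M. CLINT v|M. iexp (u \<bullet> h) * iexp (v \<bullet> k))"
      by (simp add: exp_add distrib_left)
    also have "\<dots> = (CLINT u|M. iexp (u \<bullet> h)) * (CLINT v|M. iexp (v \<bullet> k))"
      by (simp only: integral_mult_right_zero integral_mult_left_zero)
    also have "\<dots> = of_real (exp (- q h / 2) * exp (- q k / 2))"
      by (simp only: char_gaussian_measure[OF G] q_def of_real_mult)
    also have "exp (- q h / 2) * exp (- q k / 2) = exp (- (q h + q k) / 2)"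
      by (simp add: exp_add[symmetric] field_simps)
    finally show ?thesis .
  qed
  show ?thesis
  proof (rule finite_measure_char_functional_unique)
    show "finite_measure (distr (M \<Otimes>\<^sub>M M) borel rot)"
      by (intro P.finite_measure_distr) simp
    show "finite_measure (M \<Otimes>\<^sub>M M)" by unfold_locales
    fix w :: "'h \<times> 'h"
    obtain h k where w: "w = (h, k)" by force
    have "rot v \<bullet> (h, k) = v \<bullet> ((h + k) /\<^sub>R sqrt 2, (h - k) /\<^sub>R sqrt 2)" for v :: "'h \<times> 'h"
      by (simp add: rot_def inner_prod_def inner_add_left inner_add_right inner_diff_left
          inner_diff_right algebra_simps)
    then show "(CLINT v|distr (M \<Otimes>\<^sub>M M) borel rot. iexp (v \<bullet> w)) = (CLINT v|M \<Otimes>\<^sub>M M. iexp (v \<bullet> w))"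
      unfolding w by (subst integral_distr) (simp_all add: ch par)
  qed (simp_all add: sP)
qed

text \<open>As the inverse of a linear map, \<open>g\<close> commutes with \<open>rot\<close> at
  almost every pair, whatever its values off the range of \<open>\<iota>\<close>. So rotating before
  or after applying \<open>g\<close> to both coordinates yields the same image measure.\<close>

lemma rot_invariant_distr:
  fixes M :: "'h::{real_normed_vector, second_countable_topology} measure"
    and \<iota> :: "'x::{real_normed_vector, second_countable_topology} \<Rightarrow> 'h"
  assumes "prob_space M" and sM [measurable_cong]: "sets M = sets borel"
    and inv: "distr (M \<Otimes>\<^sub>M M) borel rot = M \<Otimes>\<^sub>M M" and "linear \<iota>"
    and g [measurable]: "g \<in> borel_measurable M" and gi: "\<And>x. g (\<iota> x) = x" and ig: "AE y in M. \<iota> (g y) = y"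
  shows "distr (distr M borel g \<Otimes>\<^sub>M distr M borel g) borel rot = distr M borel g \<Otimes>\<^sub>M distr M borel g"
proof -
  interpret prob_space M by fact
  interpret P: pair_prob_space M M ..
  interpret D: prob_space "distr M borel g" by (rule prob_space_distr) simp
  note sP [measurable_cong] = sets_pair_borel[OF sM]
  define gg where "gg w = (g (fst w), g (snd w))" for w
  have gM [measurable]: "g \<in> borel_measurable borel" using g by (simp cong: measurable_cong_sets add: sM)
  have [measurable]: "gg \<in> borel_measurable borel"
    unfolding gg_def borel_prod[symmetric] by measurable
  have "distr M borel g \<Otimes>\<^sub>M distr M borel g = distr (M \<Otimes>\<^sub>M M) (borel \<Otimes>\<^sub>M borel) (\<lambda>(x, y). (g x, g y))"
    by (rule pair_measure_distr) (simp_all add: D.sigma_finite_measure_axioms)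
  also have "\<dots> = distr (M \<Otimes>\<^sub>M M) borel gg"
    unfolding borel_prod gg_def case_prod_beta' by simp
  finally have pair: "distr M borel g \<Otimes>\<^sub>M distr M borel g = distr (M \<Otimes>\<^sub>M M) borel gg" .
  have AE: "AE w in M \<Otimes>\<^sub>M M. rot (gg w) = gg (rot w)"
  proof -
    \<comment> \<open>The inversion law reaches the first coordinate through its marginal
      \<open>M\<close>, and the second by swapping the factors.\<close>
    have "AE w in distr (M \<Otimes>\<^sub>M M) M fst. \<iota> (g w) = w"
      unfolding distr_pair_fst by (rule ig)
    then have f: "AE w in M \<Otimes>\<^sub>M M. \<iota> (g (fst w)) = fst w"
      by (rule AE_distrD[OF measurable_fst])
    then have "AE w in distr (M \<Otimes>\<^sub>M M) (M \<Otimes>\<^sub>M M) (\<lambda>(x, y). (y, x)). \<iota> (g (fst w)) = fst w"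
      unfolding P.distr_pair_swap[symmetric] .
    from AE_distrD[OF measurable_pair_swap' this]
    have "AE w in M \<Otimes>\<^sub>M M. \<iota> (g (snd w)) = snd w"
      by (simp add: case_prod_beta')
    with f show ?thesis
    proof eventually_elim
      case (elim w)
      have "g ((fst w + snd w) /\<^sub>R sqrt 2) = g (\<iota> ((g (fst w) + g (snd w)) /\<^sub>R sqrt 2))"
        using elim by (simp add: linear_cmul[OF \<open>linear \<iota>\<close>] linear_add[OF \<open>linear \<iota>\<close>])
      moreover have "g ((fst w - snd w) /\<^sub>R sqrt 2) = g (\<iota> ((g (fst w) - g (snd w)) /\<^sub>R sqrt 2))"
        using elim by (simp add: linear_cmul[OF \<open>linear \<iota>\<close>] linear_diff[OF \<open>linear \<iota>\<close>])
      ultimately show ?case by (simp add: gi rot_def gg_def)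
    qed
  qed
  have "distr (distr (M \<Otimes>\<^sub>M M) borel gg) borel rot = distr (M \<Otimes>\<^sub>M M) borel (\<lambda>w. rot (gg w))"
    by (subst distr_distr) (auto simp: comp_def)
  also have "\<dots> = distr (M \<Otimes>\<^sub>M M) borel (\<lambda>w. gg (rot w))"
    using AE by (intro distr_cong_AE) auto
  also have "\<dots> = distr (distr (M \<Otimes>\<^sub>M M) borel rot) borel gg"
    by (subst distr_distr) (auto simp: comp_def)
  also have "\<dots> = distr (M \<Otimes>\<^sub>M M) borel gg"
    by (simp only: inv)
  finally show ?thesis unfolding pair .
qed

section \<open>Fernique's theorem\<close>

definition tail :: "'a::real_normed_vector measure \<Rightarrow> real \<Rightarrow> real" where
  "tail M t = measure M {x. t < norm x}"

text \<open>Rotate by 45 degrees: \<open>norm (x + y) \<le> sqrt 2 * s\<close> and \<open>norm (x - y) > sqrt 2 * t\<close> force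
  both \<open>x\<close> and \<open>y\<close> to be large.\<close>

lemma rot_invariant_tail:
  fixes M :: "'x::{real_normed_vector, second_countable_topology} measure"
  assumes "prob_space M" and sM [measurable_cong]: "sets M = sets borel"
    and inv: "distr (M \<Otimes>\<^sub>M M) borel rot = M \<Otimes>\<^sub>M M"
  shows "(1 - tail M s) * tail M t \<le> (tail M ((t - s) / sqrt 2))\<^sup>2"
proof -
  interpret prob_space M by fact
  interpret P: pair_prob_space M M ..
  note sP [measurable_cong] = sets_pair_borel[OF sM]
  have sp: "space M = UNIV" using sM sets_eq_imp_space_eq[of _ borel] by auto
  have opn [measurable]: "{x::'x. t < norm x} \<in> sets borel" for t
    by (intro borel_open open_Collect_less continuous_intros)
  have cls [measurable]: "{x::'x. norm x \<le> t} \<in> sets borel" for t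
    by (intro borel_closed closed_Collect_le continuous_intros)
  define A where "A = {x::'x. norm x \<le> s} \<times> {y::'x. t < norm y}"
  define B where "B = {x::'x. (t - s) / sqrt 2 < norm x}"
  have times: "measure (M \<Otimes>\<^sub>M M) (S \<times> T) = measure M S * measure M T"
    if "S \<in> sets M" "T \<in> sets M" for S T
    using that by (simp add: measure_def emeasure_pair_measure_Times enn2real_mult)
  have "1 - tail M s = measure M {x. norm x \<le> s}"
  proof -
    have "{x. norm x \<le> s} = space M - {x. s < norm x}" using sp by auto
    then show ?thesis using prob_compl[of "{x. s < norm x}"] sM by (simp add: tail_def)
  qed
  then have "(1 - tail M s) * tail M t = measure (M \<Otimes>\<^sub>M M) A"
    unfolding A_def tail_def by (subst times) (auto simp: sM)
  also have "\<dots> = measure (distr (M \<Otimes>\<^sub>M M) borel rot) A" by (simp only: inv)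
  also have "\<dots> = measure (M \<Otimes>\<^sub>M M) (rot -` A \<inter> space (M \<Otimes>\<^sub>M M))"
    unfolding A_def borel_prod[symmetric] by (intro measure_distr) (auto simp: borel_prod)
  also have "\<dots> \<le> measure (M \<Otimes>\<^sub>M M) (B \<times> B)"
  proof (rule P.finite_measure_mono)
    show "rot -` A \<inter> space (M \<Otimes>\<^sub>M M) \<subseteq> B \<times> B"
    proof
      fix w assume "w \<in> rot -` A \<inter> space (M \<Otimes>\<^sub>M M)"
      moreover obtain x y where w: "w = (x, y)" by force
      ultimately have 1: "norm (x + y) / sqrt 2 \<le> s" "t < norm (x - y) / sqrt 2"
        by (auto simp: A_def rot_def divide_inverse mult.commute)
      have "norm (x - y) = norm (2 *\<^sub>R x - (x + y))" "norm (x - y) = norm ((x + y) - 2 *\<^sub>R y)"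
        by (simp_all add: scaleR_2)
      then have "norm (x - y) \<le> 2 * norm x + norm (x + y)" "norm (x - y) \<le> norm (x + y) + 2 * norm y"
        using norm_triangle_ineq4[of "2 *\<^sub>R x" "x + y"] norm_triangle_ineq4[of "x + y" "2 *\<^sub>R y"] by simp_all
      then have "norm (x - y) / sqrt 2 \<le> sqrt 2 * norm x + norm (x + y) / sqrt 2"
        "norm (x - y) / sqrt 2 \<le> sqrt 2 * norm y + norm (x + y) / sqrt 2"
        by (simp_all add: field_simps)
      with 1 have "t - s < sqrt 2 * norm x" "t - s < sqrt 2 * norm y" by linarith+
      then show "w \<in> B \<times> B" by (simp add: w B_def field_simps)
    qed
    show "B \<times> B \<in> sets (M \<Otimes>\<^sub>M M)" unfolding B_def by (intro pair_measureI) (auto simp: sM)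
  qed
  also have "\<dots> = (tail M ((t - s) / sqrt 2))\<^sup>2"
    unfolding B_def tail_def by (subst times) (auto simp: sM power2_eq_square)
  finally show ?thesis .
qed

lemma tail_tendsto_0:
  fixes M :: "'x::{real_normed_vector, second_countable_topology} measure"
  assumes "prob_space M" and sM: "sets M = sets borel"
  shows "(\<lambda>n. tail M (real n)) \<longlonglongrightarrow> 0"
proof -
  interpret prob_space M by fact
  have opn: "{x::'x. t < norm x} \<in> sets M" for t
    unfolding sM by (intro borel_open open_Collect_less continuous_intros)
  have "(\<lambda>n. tail M (real n)) \<longlonglongrightarrow> measure M (\<Inter>n. {x. real n < norm x})"
    unfolding tail_def using opn
    by (intro finite_Lim_measure_decseq) (auto simp: decseq_def)
  moreover have "(\<Inter>n. {x::'x. real n < norm x}) = {}"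
  proof -
    have "\<exists>n. \<not> real n < norm x" for x :: 'x
      using reals_Archimedean2[of "norm x"] by (meson less_asym)
    then show ?thesis by blast
  qed
  ultimately show ?thesis by simp
qed

text \<open>The radii satisfy \<open>(t (Suc n) - s) / sqrt 2 = t n\<close>, so by the tail
  inequality the ratio \<open>tail M (t n) / (1 - tail M s)\<close> is bounded by the square of its
  predecessor. The radii grow only like powers of \<open>sqrt 2\<close>; squared radius and exponent
  are thus both of order \<open>2 ^ n\<close>, which is Gaussian decay.\<close>

lemma tail_double_exponential:
  fixes M :: "'x::{real_normed_vector, second_countable_topology} measure"
  assumes M: "prob_space M" and sM: "sets M = sets borel"
    and inv: "distr (M \<Otimes>\<^sub>M M) borel rot = M \<Otimes>\<^sub>M M"
  obtains s t where "s > 0" and "t 0 = s" and "\<And>n. real n * s \<le> t n"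
    "\<And>n. (t n)\<^sup>2 \<le> 16 * s\<^sup>2 * 2 ^ n" "\<And>n. tail M (t n) \<le> exp (- (2 ^ n))"
proof -
  interpret prob_space M by fact
  \<comment> \<open>With 1/4 the initial ratio is at most \<open>(1/4) / (3/4) = 1/3\<close>, which
    is at most \<open>exp (- 1)\<close> because e is at most 3.\<close>
  have "eventually (\<lambda>n. tail M (real n) < 1/4) sequentially"
    by (rule order_tendstoD[OF tail_tendsto_0[OF M sM]]) simp
  then have "eventually (\<lambda>n. tail M (real n) < 1/4 \<and> n > 0) sequentially"
    using eventually_gt_at_top[of 0] by (rule eventually_conj)
  then obtain n where n: "tail M (real n) < 1/4" "n > 0"
    by (auto simp: eventually_sequentially)
  define s where "s = real n"
  have s: "s > 0" "tail M s < 1/4" using n by (auto simp: s_def)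
  define t where "t = rec_nat s (\<lambda>_ r. sqrt 2 * r + s)"
  have t0: "t 0 = s" and tS: "t (Suc n) = sqrt 2 * t n + s" for n by (simp_all add: t_def)
  have low: "real n * s \<le> t n \<and> 0 \<le> t n" for n
  proof (induction n)
    case (Suc n)
    have "1 * t n \<le> sqrt 2 * t n" using Suc by (intro mult_right_mono) auto
    then show ?case using Suc s by (simp add: tS algebra_simps)
  qed (use s t0 in auto)
  \<comment> \<open>A rational majorant of the exact solution
    \<open>s * ((2 + sqrt 2) * sqrt 2 ^ n - (1 + sqrt 2))\<close> of the recursion; the induction
    closes because \<open>4 / 3 \<le> sqrt 2\<close>.\<close>
  have up: "t n \<le> s * (4 * sqrt 2 ^ n - 3)" for n
  proof (induction n)
    case (Suc n)
    have "(4/3)\<^sup>2 \<le> (2::real)" by (simp add: power2_eq_square)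
    then have "4 / 3 \<le> sqrt 2" by (rule real_le_rsqrt)
    then have "s * (4 - 3 * sqrt 2) \<le> s * 0" using s by (intro mult_left_mono) auto
    moreover have "sqrt 2 * t n \<le> sqrt 2 * (s * (4 * sqrt 2 ^ n - 3))"
      using Suc by (intro mult_left_mono) auto
    ultimately show ?case by (simp add: tS algebra_simps)
  qed (simp add: t0)
  have sq: "(t n)\<^sup>2 \<le> 16 * s\<^sup>2 * 2 ^ n" for n
  proof -
    have "t n \<le> 4 * s * sqrt 2 ^ n" using up[of n] s by (simp add: algebra_simps)
    then have "(t n)\<^sup>2 \<le> (4 * s * sqrt 2 ^ n)\<^sup>2" using low[of n] by (intro power_mono) auto
    also have "\<dots> = 16 * s\<^sup>2 * (sqrt 2 ^ n)\<^sup>2"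
      by (simp add: power_mult_distrib)
    also have "(sqrt 2 ^ n)\<^sup>2 = (2::real) ^ n"
      by (metis power_mult mult.commute real_sqrt_pow2 zero_le_numeral)
    finally show ?thesis .
  qed
  define p where "p n = tail M (t n) / (1 - tail M s)" for n
  have tail01: "0 \<le> tail M r" "tail M r \<le> 1" for r by (simp_all add: tail_def)
  have p: "p n \<le> exp (- (2 ^ n))" for n
  proof (induction n)
    case 0
    have "p 0 \<le> 1 / 3" using s by (simp add: p_def t0 field_simps)
    also have "\<dots> \<le> 1 / exp 1" using exp_le by (intro divide_left_mono) auto
    finally show ?case by (simp add: exp_minus inverse_eq_divide)
  next
    case (Suc n)
    have "(t (Suc n) - s) / sqrt 2 = t n" by (simp add: tS)
    then have "(1 - tail M s) * tail M (t (Suc n)) \<le> (tail M (t n))\<^sup>2"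
      using rot_invariant_tail[OF M sM inv, of s "t (Suc n)"] by simp
    then have "(1 - tail M s) * tail M (t (Suc n)) / (1 - tail M s)\<^sup>2 \<le> (tail M (t n))\<^sup>2 / (1 - tail M s)\<^sup>2"
      by (rule divide_right_mono) simp
    then have "p (Suc n) \<le> (p n)\<^sup>2"
      using s by (simp add: p_def power2_eq_square power_divide)
    also have "\<dots> \<le> (exp (- (2 ^ n)))\<^sup>2"
      using Suc s tail01 by (intro power_mono) (auto simp: p_def)
    finally show ?case by (simp add: power2_eq_square exp_add[symmetric])
  qed
  have "tail M (t n) \<le> exp (- (2 ^ n))" for n
  proof -
    have "tail M (t n) \<le> p n"
      using s tail01 by (simp add: p_def field_simps mult_left_le)
    then show ?thesis using p[of n] by simp
  qed
  then show thesis using that[of s t] s t0 low sq by blast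
qed

text \<open>Cut the space into shells between consecutive radii. On the shell starting at
  \<open>t n\<close> the integrand is at most \<open>exp (2 ^ n / 2)\<close> and the mass at most
  \<open>exp (- (2 ^ n))\<close>, so the contributions are summable.\<close>

theorem fernique:
  fixes M :: "'x::{real_normed_vector, second_countable_topology} measure"
  assumes M: "prob_space M" and sM [measurable_cong]: "sets M = sets borel"
    and inv: "distr (M \<Otimes>\<^sub>M M) borel rot = M \<Otimes>\<^sub>M M"
  shows "\<exists>a>0. integrable M (\<lambda>u. exp (a * (norm u)\<^sup>2))"
proof -
  interpret prob_space M by fact
  obtain s t where s: "s > 0" and t0: "t 0 = s" and low: "\<And>n. real n * s \<le> t n"
    and sq: "\<And>n. (t n)\<^sup>2 \<le> 16 * s\<^sup>2 * 2 ^ n" and tl: "\<And>n. tail M (t n) \<le> exp (- (2 ^ n))"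
    using tail_double_exponential[OF M sM inv] by metis
  \<comment> \<open>64 = 16 * 2 * 2: the factor 16 in the bound on the radii, the shift from
    \<open>n\<close> to \<open>Suc n\<close>, and the wish to use only half of the exponent in the
    tail bound.\<close>
  define a where "a = 1 / (64 * s\<^sup>2)"
  have a: "a > 0" using s by (simp add: a_def)
  have opn [measurable]: "{x::'x. r < norm x} \<in> sets M" for r
    unfolding sM by (intro borel_open open_Collect_less continuous_intros)
  define F where "F n u = ennreal (exp (2 ^ n / 2)) * indicator {x. t n < norm x} u" for n and u :: 'x
  have pw: "ennreal (exp (a * (norm u)\<^sup>2)) \<le> ennreal (exp (a * s\<^sup>2)) + (\<Sum>n. F n u)" for u
  proof (cases "norm u \<le> s")
    case True
    then have "exp (a * (norm u)\<^sup>2) \<le> exp (a * s\<^sup>2)" using a by (simp add: power_mono)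
    then have "ennreal (exp (a * (norm u)\<^sup>2)) \<le> ennreal (exp (a * s\<^sup>2))" by (rule ennreal_leI)
    then show ?thesis by (rule order_trans) simp
  next
    case False
    obtain m where "norm u < real m * s" using reals_Archimedean3[OF s] by blast
    then have ex: "norm u \<le> t m" using low[of m] by simp
    \<comment> \<open>The first radius that reaches \<open>norm u\<close>. It is not
      \<open>t 0 = s\<close>, so a predecessor exists and names the shell.\<close>
    define m' where "m' = (LEAST m. norm u \<le> t m)"
    have m': "norm u \<le> t m'" unfolding m'_def using ex by (rule LeastI)
    then have "m' \<noteq> 0" using False t0 by (intro notI) simp
    then obtain n where n: "m' = Suc n" using not0_implies_Suc by blast
    have "t n < norm u" using not_less_Least[of n "\<lambda>m. norm u \<le> t m"] n by (simp add: m'_def)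
    have "(norm u)\<^sup>2 \<le> (t (Suc n))\<^sup>2" using m' n by (intro power_mono) auto
    also have "\<dots> \<le> 16 * s\<^sup>2 * 2 ^ Suc n" by (rule sq)
    finally have "a * (norm u)\<^sup>2 \<le> a * (16 * s\<^sup>2 * 2 ^ Suc n)" using a by (intro mult_left_mono) auto
    also have "\<dots> = 2 ^ n / 2" using s by (simp add: a_def)
    finally have "ennreal (exp (a * (norm u)\<^sup>2)) \<le> F n u"
      using \<open>t n < norm u\<close> by (simp add: F_def)
    also have "\<dots> \<le> (\<Sum>n. F n u)" using sum_le_suminf[of "\<lambda>n. F n u" "{n}"] by simp
    finally show ?thesis by (rule order_trans) simp
  qed
  have "(\<integral>\<^sup>+u. ennreal (exp (a * (norm u)\<^sup>2)) \<partial>M) \<le> (\<integral>\<^sup>+u. ennreal (exp (a * s\<^sup>2)) + (\<Sum>n. F n u) \<partial>M)"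
    by (intro nn_integral_mono pw)
  also have "\<dots> = ennreal (exp (a * s\<^sup>2)) + (\<Sum>n. \<integral>\<^sup>+u. F n u \<partial>M)"
    unfolding F_def by (simp add: nn_integral_add nn_integral_suminf emeasure_space_1)
  also have "(\<Sum>n. \<integral>\<^sup>+u. F n u \<partial>M) \<le> (\<Sum>n. ennreal (exp (- 1 / 2) ^ n))"
  proof (intro suminf_le)
    fix n
    have "(\<integral>\<^sup>+u. F n u \<partial>M) = ennreal (exp (2 ^ n / 2)) * ennreal (tail M (t n))"
      unfolding F_def tail_def by (simp add: nn_integral_cmult_indicator emeasure_eq_measure)
    also have "\<dots> = ennreal (exp (2 ^ n / 2) * tail M (t n))"
      by (simp add: ennreal_mult tail_def)
    also have "\<dots> \<le> ennreal (exp (- 1 / 2) ^ n)"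
    proof (rule ennreal_leI)
      have "exp (2 ^ n / 2) * tail M (t n) \<le> exp (2 ^ n / 2) * exp (- (2 ^ n))"
        using tl by (intro mult_left_mono) auto
      also have "\<dots> = exp (- (2 ^ n) / 2)" by (simp add: exp_add[symmetric] field_simps)
      \<comment> \<open>Since \<open>n < 2 ^ n\<close>, the doubly exponential terms are dominated
        by a geometric series.\<close>
      also have "\<dots> \<le> exp (real n * (- 1 / 2))"
        using of_nat_less_two_power[of n, where 'a = real] by (simp add: less_imp_le)
      also have "\<dots> = exp (- 1 / 2) ^ n" by (rule exp_of_nat_mult)
      finally show "exp (2 ^ n / 2) * tail M (t n) \<le> exp (- 1 / 2) ^ n" .
    qed
    finally show "(\<integral>\<^sup>+u. F n u \<partial>M) \<le> ennreal (exp (- 1 / 2) ^ n)" .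
  qed simp_all
  also have "(\<Sum>n. ennreal (exp (- 1 / 2) ^ n)) = ennreal (\<Sum>n. exp (- 1 / 2) ^ n)"
    by (rule suminf_ennreal2) (auto intro!: summable_geometric)
  finally have "(\<integral>\<^sup>+u. ennreal (exp (a * (norm u)\<^sup>2)) \<partial>M) \<le>
      ennreal (exp (a * s\<^sup>2)) + ennreal (\<Sum>n. exp (- 1 / 2) ^ n)"
    by (simp add: add_left_mono)
  also have "\<dots> < \<infinity>" by simp
  finally have "(\<integral>\<^sup>+u. ennreal (exp (a * (norm u)\<^sup>2)) \<partial>M) < \<infinity>" .
  then have "integrable M (\<lambda>u. exp (a * (norm u)\<^sup>2))"
    by (intro integrableI_bounded) simp_all
  with a show ?thesis by blast
qed

section \<open>Hellinger distance of two densities\<close>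

text \<open>Independence of the reference measure. As \<open>f\<close> is strictly positive, null
  sets of \<open>density M f\<close> are null for \<open>M\<close>, so \<open>M\<close> has a
  density \<open>D\<close> with respect to \<open>\<nu>\<close>. Both derivatives carry the factor
  \<open>D\<close>, which leaves the square once and turns integration over \<open>\<nu>\<close>
  into integration over \<open>M\<close>.\<close>

lemma hellinger_dist_density:
  fixes f f' :: "'a \<Rightarrow> real"
  assumes "sigma_finite_measure \<nu>" "finite_measure M" and sets [measurable_cong]: "sets \<nu> = sets M"
    and f [measurable]: "f \<in> borel_measurable M" "f' \<in> borel_measurable M"
    and pos: "\<And>u. 0 < f u" "\<And>u. 0 \<le> f' u"
    and ac: "absolutely_continuous \<nu> (density M f)"
  shows "hellinger_dist \<nu> (density M f) (density M f') =
    sqrt (1 / 2 * (\<integral>u. (sqrt (f u) - sqrt (f' u))\<^sup>2 \<partial>M))"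
proof -
  interpret \<nu>: sigma_finite_measure \<nu> by fact
  have "A \<in> null_sets M" if A: "A \<in> null_sets (density M f)" for A
  proof -
    have "A \<in> sets M" and AE: "AE x in M. x \<in> A \<longrightarrow> ennreal (f x) = 0"
      using A by (auto simp: null_sets_density_iff)
    moreover have "AE x in M. x \<notin> A"
      using AE by eventually_elim (use pos(1) in \<open>auto simp: ennreal_eq_0_iff not_less[symmetric]\<close>)
    ultimately show ?thesis by (simp add: AE_iff_null_sets)
  qed
  then have acM: "absolutely_continuous \<nu> M"
    using ac by (auto simp: absolutely_continuous_def)
  obtain D where D [measurable]: "D \<in> borel_measurable \<nu>"
    and RN: "AE x in \<nu>. RN_deriv \<nu> M x = ennreal (D x)" and D0: "\<And>x. 0 \<le> D x"
    using \<nu>.real_RN_deriv[OF \<open>finite_measure M\<close> acM sets[symmetric]] by metis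
  have "M = density \<nu> (RN_deriv \<nu> M)"
    using \<nu>.density_RN_deriv[OF acM sets[symmetric]] by simp
  also have "\<dots> = density \<nu> (\<lambda>x. ennreal (D x))"
    using RN by (intro density_cong) auto
  finally have M: "M = density \<nu> (\<lambda>x. ennreal (D x))" .
  have dens: "AE x in \<nu>. ennreal (D x) * ennreal (g x) = RN_deriv \<nu> (density M g) x"
    if g: "g \<in> borel_measurable M" for g
  proof (rule \<nu>.RN_deriv_unique)
    have g' [measurable]: "g \<in> borel_measurable \<nu>" using g by (simp cong: measurable_cong_sets add: sets)
    show "(\<lambda>x. ennreal (D x) * ennreal (g x)) \<in> borel_measurable \<nu>" by measurable
    show "density \<nu> (\<lambda>x. ennreal (D x) * ennreal (g x)) = density M g"
      by (subst M, subst density_density_eq) auto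
  qed
  have "(\<integral>u. (sqrt (enn2real (RN_deriv \<nu> (density M f) u)) - sqrt (enn2real (RN_deriv \<nu> (density M f') u)))\<^sup>2 \<partial>\<nu>)
      = (\<integral>u. D u *\<^sub>R (sqrt (f u) - sqrt (f' u))\<^sup>2 \<partial>\<nu>)"
  proof (rule integral_cong_AE)
    show "AE u in \<nu>. (sqrt (enn2real (RN_deriv \<nu> (density M f) u)) - sqrt (enn2real (RN_deriv \<nu> (density M f') u)))\<^sup>2
      = D u *\<^sub>R (sqrt (f u) - sqrt (f' u))\<^sup>2"
      using dens[OF f(1)] dens[OF f(2)]
    proof eventually_elim
      case (elim u)
      have "enn2real (RN_deriv \<nu> (density M f) u) = D u * f u"
        "enn2real (RN_deriv \<nu> (density M f') u) = D u * f' u"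
        using D0[of u] pos(1)[of u] pos(2)[of u] unfolding elim[symmetric] enn2real_mult by simp_all
      then show ?case
        using D0[of u] by (simp add: real_sqrt_mult power_mult_distrib flip: right_diff_distrib)
    qed
  qed measurable
  also have "\<dots> = (\<integral>u. (sqrt (f u) - sqrt (f' u))\<^sup>2 \<partial>M)"
  proof -
    have "(\<integral>u. (sqrt (f u) - sqrt (f' u))\<^sup>2 \<partial>density \<nu> (\<lambda>x. ennreal (D x))) =
        (\<integral>u. D u *\<^sub>R (sqrt (f u) - sqrt (f' u))\<^sup>2 \<partial>\<nu>)"
      using D0 by (intro integral_density) auto
    then show ?thesis by (simp only: M[symmetric])
  qed
  finally show ?thesis by (simp add: hellinger_dist_def)
qed

section \<open>Elementary inequalities for integrals, exponentials and powers\<close>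

lemma norm_integral_le_integral:
  fixes f :: "'a \<Rightarrow> 'b::{banach, second_countable_topology}"
  assumes "integrable M f" "integrable M g" "\<And>u. norm (f u) \<le> g u"
  shows "norm (\<integral>u. f u \<partial>M) \<le> (\<integral>u. g u \<partial>M)"
  using assms by (intro order_trans[OF integral_norm_bound integral_mono]) auto

text \<open>A mean value estimate. In use, \<open>m\<close> is the quadratic lower bound of the
  potentials and varies with the point.\<close>

lemma abs_exp_diff_le:
  fixes x y m :: real
  assumes "m \<le> x" "m \<le> y"
  shows "\<bar>exp (- x) - exp (- y)\<bar> \<le> exp (- m) * \<bar>x - y\<bar>"
proof -
  have *: "exp (- x) - exp (- y) \<le> exp (- m) * (y - x)" if "m \<le> x" "x \<le> y" for x y
  proof -
    have "exp (- x) - exp (- y) = exp (- x) * (1 - exp (- (y - x)))"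
      by (simp add: algebra_simps exp_add[symmetric])
    also have "\<dots> \<le> exp (- x) * (y - x)"
    proof (rule mult_left_mono)
      show "1 - exp (- (y - x)) \<le> y - x" using exp_ge_add_one_self[of "- (y - x)"] by linarith
    qed simp
    also have "\<dots> \<le> exp (- m) * (y - x)" using that by (intro mult_right_mono) auto
    finally show ?thesis .
  qed
  show ?thesis using *[of x y] *[of y x] assms by (cases "x \<le> y") auto
qed

text \<open>Exponentiate \<open>p / 2 * ln (c * x\<^sup>2) \<le> p / 2 * (c * x\<^sup>2)\<close>;
  the choice \<open>c = 2 * \<epsilon> / p\<close> makes the right-hand side
  \<open>\<epsilon> * x\<^sup>2\<close>.\<close>

lemma powr_le_exp_square:
  fixes x p \<epsilon> :: real
  assumes "p > 0" "\<epsilon> > 0" "x \<ge> 0"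
  shows "x powr p \<le> (p / (2 * \<epsilon>)) powr (p / 2) * exp (\<epsilon> * x\<^sup>2)"
proof (cases "x = 0")
  case False
  define c where "c = 2 * \<epsilon> / p"
  have c: "c > 0" using assms by (simp add: c_def)
  have "ln (c * x\<^sup>2) \<le> c * x\<^sup>2"
    using ln_le_minus_one[of "c * x\<^sup>2"] c False by simp
  then have "p / 2 * (ln c + 2 * ln x) \<le> p / 2 * (c * x\<^sup>2)"
    using assms c False by (intro mult_left_mono) (auto simp: ln_mult ln_realpow)
  then have "p * ln x \<le> \<epsilon> * x\<^sup>2 - p / 2 * ln c"
    using assms by (simp add: c_def field_simps)
  then have "exp (p * ln x) \<le> exp (\<epsilon> * x\<^sup>2 + p / 2 * ln (1 / c))"
    using c by (simp add: ln_div)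
  also have "\<dots> = (1 / c) powr (p / 2) * exp (\<epsilon> * x\<^sup>2)"
    using c by (simp add: powr_def exp_add)
  finally show ?thesis using False assms by (simp add: powr_def c_def)
qed simp

lemma power_le_exp_square:
  fixes x \<epsilon> :: real
  assumes "n > 0" "\<epsilon> > 0" "x \<ge> 0"
  shows "x ^ n \<le> (real n / (2 * \<epsilon>)) powr (real n / 2) * exp (\<epsilon> * x\<^sup>2)"
  using powr_le_exp_square[of "real n" \<epsilon> x] assms by (cases "x = 0") (auto simp: powr_realpow power_0_left)

section \<open>Perturbation of Gibbs densities\<close>

text \<open>What the estimates retain of the setting: one square-exponential moment in place of
  Gaussianity, and potentials that already contain the logarithm of the normalising constant, so
  that densities are pure exponentials.\<close>

locale gibbs_perturbation = prob_space M
  for M :: "'x::{banach, second_countable_topology} measure" +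
  fixes a :: real and \<Psi> :: "'x \<Rightarrow> real" and \<Psi>N :: "nat \<Rightarrow> 'x \<Rightarrow> real" and \<psi> :: "nat \<Rightarrow> real"
  assumes sets_M [measurable_cong]: "sets M = sets borel"
    and a_pos: "a > 0" and exp_int: "integrable M (\<lambda>u. exp (a * (norm u)\<^sup>2))"
    and meas [measurable]: "\<Psi> \<in> borel_measurable borel" "\<And>N. \<Psi>N N \<in> borel_measurable borel"
    and lower: "\<And>\<epsilon>. \<epsilon> > 0 \<Longrightarrow> \<exists>m. \<forall>u N. m - \<epsilon> * (norm u)\<^sup>2 \<le> \<Psi> u \<and> m - \<epsilon> * (norm u)\<^sup>2 \<le> \<Psi>N N u"
    and approx: "\<And>\<epsilon>. \<epsilon> > 0 \<Longrightarrow> \<exists>K\<ge>0. \<forall>u N. \<bar>\<Psi> u - \<Psi>N N u\<bar> \<le> K * exp (\<epsilon> * (norm u)\<^sup>2) * \<psi> N"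
    and normalised: "(\<integral>u. exp (- \<Psi> u) \<partial>M) = 1" "\<And>N. (\<integral>u. exp (- \<Psi>N N u) \<partial>M) = 1"
    and \<psi>_nonneg: "\<And>N. 0 \<le> \<psi> N" and \<psi>_bounded: "\<exists>B. \<forall>N. \<psi> N \<le> B"
begin

definition \<mu> :: "'x measure" where "\<mu> = density M (\<lambda>u. ennreal (exp (- \<Psi> u)))"

definition \<mu>N :: "nat \<Rightarrow> 'x measure" where "\<mu>N N = density M (\<lambda>u. ennreal (exp (- \<Psi>N N u)))"

lemma sets_\<mu> [simp, measurable_cong]: "sets \<mu> = sets borel" "sets (\<mu>N N) = sets borel"
  by (simp_all add: \<mu>_def \<mu>N_def sets_M)

lemma prob_space_exp_density:
  assumes [measurable]: "g \<in> borel_measurable borel" and g: "(\<integral>u. exp (- g u) \<partial>M) = 1"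
  shows "prob_space (density M (\<lambda>u. ennreal (exp (- g u))))"
proof
  \<comment> \<open>A non-integrable function would have Bochner integral 0, not 1.\<close>
  have "integrable M (\<lambda>u. exp (- g u))"
    using g not_integrable_integral_eq[of M "\<lambda>u. exp (- g u)"] by force
  then have "(\<integral>\<^sup>+u. ennreal (exp (- g u)) \<partial>M) = 1"
    using g by (subst nn_integral_eq_integral) auto
  then show "emeasure (density M (\<lambda>u. ennreal (exp (- g u)))) (space (density M (\<lambda>u. ennreal (exp (- g u))))) = 1"
    by (simp add: emeasure_density cong: nn_integral_cong)
qed

lemma prob_space_\<mu>: "prob_space \<mu>" "prob_space (\<mu>N N)"
  unfolding \<mu>_def \<mu>N_def by (intro prob_space_exp_density meas normalised)+

text \<open>The factor \<open>b\<close> covers the densities (\<open>b = 1\<close>) and their square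
  roots (\<open>b = 1/2\<close>). Half of \<open>\<delta>\<close> pays for the lower bound of the
  potentials, scaled by \<open>b\<close>, and half for the approximation error.\<close>

lemma exp_diff:
  assumes "b > 0" "\<delta> > 0"
  shows "\<exists>C\<ge>0. \<forall>u N. \<bar>exp (- (b * \<Psi> u)) - exp (- (b * \<Psi>N N u))\<bar> \<le> C * \<psi> N * exp (\<delta> * (norm u)\<^sup>2)"
proof -
  obtain m where m: "\<And>u N. m - \<delta> / (2 * b) * (norm u)\<^sup>2 \<le> \<Psi> u"
    "\<And>u N. m - \<delta> / (2 * b) * (norm u)\<^sup>2 \<le> \<Psi>N N u"
    using lower[of "\<delta> / (2 * b)"] assms by auto
  obtain K where K: "K \<ge> 0" "\<And>u N. \<bar>\<Psi> u - \<Psi>N N u\<bar> \<le> K * exp (\<delta> / 2 * (norm u)\<^sup>2) * \<psi> N"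
    using approx[of "\<delta> / 2"] assms by auto
  have "\<bar>exp (- (b * \<Psi> u)) - exp (- (b * \<Psi>N N u))\<bar> \<le>
      (exp (- (b * m)) * b * K) * \<psi> N * exp (\<delta> * (norm u)\<^sup>2)" for u N
  proof -
    have "b * (m - \<delta> / (2 * b) * (norm u)\<^sup>2) \<le> b * \<Psi> u" "b * (m - \<delta> / (2 * b) * (norm u)\<^sup>2) \<le> b * \<Psi>N N u"
      using m assms by (auto intro!: mult_left_mono)
    then have "\<bar>exp (- (b * \<Psi> u)) - exp (- (b * \<Psi>N N u))\<bar> \<le>
        exp (- (b * (m - \<delta> / (2 * b) * (norm u)\<^sup>2))) * \<bar>b * \<Psi> u - b * \<Psi>N N u\<bar>"
      by (rule abs_exp_diff_le)
    also have "\<bar>b * \<Psi> u - b * \<Psi>N N u\<bar> = b * \<bar>\<Psi> u - \<Psi>N N u\<bar>"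
      using assms by (simp add: abs_mult flip: right_diff_distrib)
    also have "exp (- (b * (m - \<delta> / (2 * b) * (norm u)\<^sup>2))) * (b * \<bar>\<Psi> u - \<Psi>N N u\<bar>) \<le>
        exp (- (b * (m - \<delta> / (2 * b) * (norm u)\<^sup>2))) * (b * (K * exp (\<delta> / 2 * (norm u)\<^sup>2) * \<psi> N))"
      using K(2) assms by (intro mult_left_mono) auto
    also have "exp (- (b * (m - \<delta> / (2 * b) * (norm u)\<^sup>2))) = exp (- (b * m)) * exp (\<delta> / 2 * (norm u)\<^sup>2)"
      using assms by (simp add: exp_add[symmetric] field_simps)
    also have "exp (- (b * m)) * exp (\<delta> / 2 * (norm u)\<^sup>2) * (b * (K * exp (\<delta> / 2 * (norm u)\<^sup>2) * \<psi> N)) =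
        (exp (- (b * m)) * b * K) * \<psi> N * (exp (\<delta> / 2 * (norm u)\<^sup>2) * exp (\<delta> / 2 * (norm u)\<^sup>2))"
      by (simp only: mult_ac)
    also have "exp (\<delta> / 2 * (norm u)\<^sup>2) * exp (\<delta> / 2 * (norm u)\<^sup>2) = exp (\<delta> * (norm u)\<^sup>2)"
      by (simp add: exp_add[symmetric])
    finally show ?thesis .
  qed
  then show ?thesis using K(1) assms by (intro exI[of _ "exp (- (b * m)) * b * K"]) auto
qed

text \<open>Square roots of the densities are exponentials of halved potentials. With
  \<open>\<delta> = a / 2\<close> the square of the pointwise estimate has the integrable majorant
  \<open>exp (a * (norm u)\<^sup>2)\<close>, up to a constant factor.\<close>

lemma hellinger_bound:
  "\<exists>C. \<forall>N \<nu>. sigma_finite_measure \<nu> \<longrightarrow> sets \<nu> = sets borel \<longrightarrow> absolutely_continuous \<nu> \<mu> \<longrightarrow>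
     hellinger_dist \<nu> \<mu> (\<mu>N N) \<le> C * \<psi> N"
proof -
  define E where "E = (\<integral>u. exp (a * (norm u)\<^sup>2) \<partial>M)"
  have E: "E \<ge> 0" by (simp add: E_def)
  obtain C where C: "C \<ge> 0" and diff: "\<And>u N. \<bar>exp (- (1/2 * \<Psi> u)) - exp (- (1/2 * \<Psi>N N u))\<bar> \<le>
      C * \<psi> N * exp (a / 2 * (norm u)\<^sup>2)"
    using exp_diff[of "1/2" "a/2"] a_pos by auto
  have "hellinger_dist \<nu> \<mu> (\<mu>N N) \<le> C * sqrt E * \<psi> N"
    if "sigma_finite_measure \<nu>" "sets \<nu> = sets borel" "absolutely_continuous \<nu> \<mu>" for N \<nu>
  proof -
    have half: "sqrt (exp (- x)) = exp (- (1/2 * x))" for x :: real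
      by (rule real_sqrt_unique) (simp_all add: power2_eq_square exp_add[symmetric])
    have pw: "(exp (- (1/2 * \<Psi> u)) - exp (- (1/2 * \<Psi>N N u)))\<^sup>2 \<le> (C * \<psi> N)\<^sup>2 * exp (a * (norm u)\<^sup>2)" for u
    proof -
      have "(exp (- (1/2 * \<Psi> u)) - exp (- (1/2 * \<Psi>N N u)))\<^sup>2 \<le> (C * \<psi> N * exp (a / 2 * (norm u)\<^sup>2))\<^sup>2"
        using power_mono[OF diff abs_ge_zero, where n = 2] by simp
      also have "\<dots> = (C * \<psi> N)\<^sup>2 * exp (a * (norm u)\<^sup>2)"
        by (simp add: power_mult_distrib power2_eq_square exp_add[symmetric])
      finally show ?thesis .
    qed
    have "hellinger_dist \<nu> \<mu> (\<mu>N N) =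
        sqrt (1 / 2 * (\<integral>u. (sqrt (exp (- \<Psi> u)) - sqrt (exp (- \<Psi>N N u)))\<^sup>2 \<partial>M))"
      unfolding \<mu>_def \<mu>N_def using that finite_measure_axioms
      by (intro hellinger_dist_density) (auto simp: sets_M \<mu>_def)
    also have "\<dots> = sqrt (1 / 2 * (\<integral>u. (exp (- (1/2 * \<Psi> u)) - exp (- (1/2 * \<Psi>N N u)))\<^sup>2 \<partial>M))"
      by (simp only: half)
    also have "\<dots> \<le> sqrt (1 / 2 * (\<integral>u. (C * \<psi> N)\<^sup>2 * exp (a * (norm u)\<^sup>2) \<partial>M))"
    proof (intro real_sqrt_le_mono mult_left_mono integral_mono)
      show int: "integrable M (\<lambda>u. (C * \<psi> N)\<^sup>2 * exp (a * (norm u)\<^sup>2))"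
        using exp_int by simp
      show "integrable M (\<lambda>u. (exp (- (1/2 * \<Psi> u)) - exp (- (1/2 * \<Psi>N N u)))\<^sup>2)"
        by (rule Bochner_Integration.integrable_bound[OF int]) (use pw in \<open>auto simp: abs_mult\<close>)
    qed (use pw in auto)
    also have "\<dots> = sqrt (1 / 2 * ((C * \<psi> N)\<^sup>2 * E))" by (simp add: E_def)
    also have "\<dots> \<le> sqrt ((C * \<psi> N)\<^sup>2 * E)" using E by (intro real_sqrt_le_mono) auto
    also have "\<dots> = C * sqrt E * \<psi> N" using C \<psi>_nonneg[of N] by (simp add: real_sqrt_mult)
    finally show ?thesis .
  qed
  then show ?thesis by blast
qed

text \<open>The constant is uniform over all observables \<open>h\<close>, which for the covariance operators is
  used with \<open>h\<close> depending on a direction.\<close>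

lemma observable_bound:
  "\<exists>C\<ge>0. \<forall>(h :: 'x \<Rightarrow> 'b::{banach, second_countable_topology}) D.
     h \<in> borel_measurable borel \<longrightarrow> (\<forall>u. norm (h u) \<le> D * exp (a / 2 * (norm u)\<^sup>2)) \<longrightarrow>
     integrable \<mu> h \<and> (\<forall>N. integrable (\<mu>N N) h \<and>
       norm ((\<integral>u. h u \<partial>\<mu>) - (\<integral>u. h u \<partial>\<mu>N N)) \<le> C * D * \<psi> N)"
proof -
  define E where "E = (\<integral>u. exp (a * (norm u)\<^sup>2) \<partial>M)"
  have E: "E \<ge> 0" by (simp add: E_def)
  \<comment> \<open>Half of the exponent \<open>a\<close> goes to the difference of the densities;
    the other half is left for the growth of \<open>h\<close>.\<close>
  obtain C where C: "C \<ge> 0" and diff: "\<And>u N. \<bar>exp (- \<Psi> u) - exp (- \<Psi>N N u)\<bar> \<le>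
      C * \<psi> N * exp (a / 2 * (norm u)\<^sup>2)"
    using exp_diff[of 1 "a/2"] a_pos by auto
  obtain m where m: "\<And>u N. m - a / 2 * (norm u)\<^sup>2 \<le> \<Psi> u" "\<And>u N. m - a / 2 * (norm u)\<^sup>2 \<le> \<Psi>N N u"
    using lower[of "a / 2"] a_pos by auto
  have sq: "exp (a / 2 * (norm u)\<^sup>2) * exp (a / 2 * (norm u)\<^sup>2) = exp (a * (norm u)\<^sup>2)" for u :: 'x
    by (simp add: exp_add[symmetric])
  show ?thesis
  proof (intro exI[of _ "C * E"] conjI allI impI)
    fix h :: "'x \<Rightarrow> 'b" and D
    assume h [measurable]: "h \<in> borel_measurable borel" and D: "\<forall>u. norm (h u) \<le> D * exp (a / 2 * (norm u)\<^sup>2)"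
    have int: "integrable M (\<lambda>u. exp (- g u) *\<^sub>R h u)"
      if g [measurable]: "g \<in> borel_measurable borel" and lo: "\<And>u. m - a / 2 * (norm u)\<^sup>2 \<le> g u" for g
    proof (rule Bochner_Integration.integrable_bound)
      show "integrable M (\<lambda>u. exp (- m) * D * exp (a * (norm u)\<^sup>2))" using exp_int by simp
      have "norm (exp (- g u) *\<^sub>R h u) \<le> norm (exp (- m) * D * exp (a * (norm u)\<^sup>2))" for u
      proof -
        have "norm (exp (- g u) *\<^sub>R h u) = exp (- g u) * norm (h u)" by simp
        also have "\<dots> \<le> exp (- (m - a / 2 * (norm u)\<^sup>2)) * (D * exp (a / 2 * (norm u)\<^sup>2))"
          using lo[of u] D by (intro mult_mono) auto
        also have "exp (- (m - a / 2 * (norm u)\<^sup>2)) = exp (- m) * exp (a / 2 * (norm u)\<^sup>2)"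
          by (simp add: exp_add[symmetric])
        also have "\<dots> * (D * exp (a / 2 * (norm u)\<^sup>2)) = exp (- m) * D * exp (a * (norm u)\<^sup>2)"
          unfolding sq[symmetric] by (simp only: mult_ac)
        finally show ?thesis by simp
      qed
      then show "AE u in M. norm (exp (- g u) *\<^sub>R h u) \<le> norm (exp (- m) * D * exp (a * (norm u)\<^sup>2))"
        by simp
    qed measurable
    note i = int[OF meas(1) m(1)] and iN = int[OF meas(2) m(2)]
    show "integrable \<mu> h" unfolding \<mu>_def using i by (subst integrable_density) auto
    fix N
    show "integrable (\<mu>N N) h" unfolding \<mu>N_def using iN by (subst integrable_density) auto
    have "(\<integral>u. h u \<partial>\<mu>) - (\<integral>u. h u \<partial>\<mu>N N) = (\<integral>u. exp (- \<Psi> u) *\<^sub>R h u \<partial>M) - (\<integral>u. exp (- \<Psi>N N u) *\<^sub>R h u \<partial>M)"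
      unfolding \<mu>_def \<mu>N_def by (simp add: integral_density)
    also have "\<dots> = (\<integral>u. exp (- \<Psi> u) *\<^sub>R h u - exp (- \<Psi>N N u) *\<^sub>R h u \<partial>M)"
      using i iN[of N] by (simp add: Bochner_Integration.integral_diff)
    also have "norm \<dots> \<le> (\<integral>u. C * \<psi> N * D * exp (a * (norm u)\<^sup>2) \<partial>M)"
    proof (rule norm_integral_le_integral)
      fix u :: 'x
      have "norm (exp (- \<Psi> u) *\<^sub>R h u - exp (- \<Psi>N N u) *\<^sub>R h u) = \<bar>exp (- \<Psi> u) - exp (- \<Psi>N N u)\<bar> * norm (h u)"
        by (simp flip: scaleR_diff_left)
      also have "\<dots> \<le> (C * \<psi> N * exp (a / 2 * (norm u)\<^sup>2)) * (D * exp (a / 2 * (norm u)\<^sup>2))"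
        using diff D C \<psi>_nonneg by (intro mult_mono) auto
      also have "\<dots> = C * \<psi> N * D * exp (a * (norm u)\<^sup>2)"
        unfolding sq[symmetric] by (simp only: mult_ac)
      finally show "norm (exp (- \<Psi> u) *\<^sub>R h u - exp (- \<Psi>N N u) *\<^sub>R h u) \<le> C * \<psi> N * D * exp (a * (norm u)\<^sup>2)" .
    qed (use i iN[of N] exp_int in auto)
    also have "\<dots> = C * E * D * \<psi> N" by (simp add: E_def)
    finally show "norm ((\<integral>u. h u \<partial>\<mu>) - (\<integral>u. h u \<partial>\<mu>N N)) \<le> C * E * D * \<psi> N" .
  qed (use C E in auto)
qed

lemma powr_norm_dominated:
  assumes "p > 0"
  shows "\<exists>D. \<forall>u::'x. norm (norm u powr p) \<le> D * exp (a / 2 * (norm u)\<^sup>2)"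
  using powr_le_exp_square[OF assms, of "a / 2"] a_pos
  by (intro exI[of _ "(p / (2 * (a / 2))) powr (p / 2)"]) auto

lemma power_norm_dominated:
  assumes "n > 0"
  shows "\<exists>D\<ge>0. \<forall>u::'x. norm u ^ n \<le> D * exp (a / 2 * (norm u)\<^sup>2)"
  using power_le_exp_square[OF assms, of "a / 2"] a_pos
  by (intro exI[of _ "(real n / (2 * (a / 2))) powr (real n / 2)"]) auto

lemma moment_bound:
  assumes "p > 0"
  shows "integrable \<mu> (\<lambda>u. norm u powr p) \<and> (\<forall>N. integrable (\<mu>N N) (\<lambda>u. norm u powr p)) \<and>
    (\<exists>C. \<forall>N. \<bar>(\<integral>u. norm u powr p \<partial>\<mu>) - (\<integral>u. norm u powr p \<partial>\<mu>N N)\<bar> \<le> C * \<psi> N)"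
proof -
  obtain D where D: "\<forall>u::'x. norm (norm u powr p) \<le> D * exp (a / 2 * (norm u)\<^sup>2)"
    using powr_norm_dominated[OF assms] by blast
  obtain C where "\<forall>(h :: 'x \<Rightarrow> real) D. h \<in> borel_measurable borel \<longrightarrow>
      (\<forall>u. norm (h u) \<le> D * exp (a / 2 * (norm u)\<^sup>2)) \<longrightarrow>
      integrable \<mu> h \<and> (\<forall>N. integrable (\<mu>N N) h \<and>
        norm ((\<integral>u. h u \<partial>\<mu>) - (\<integral>u. h u \<partial>\<mu>N N)) \<le> C * D * \<psi> N)"
    using observable_bound[where 'b = real] by blast
  from this[rule_format, of "\<lambda>u. norm u powr p", OF _ D[rule_format]]
  show ?thesis by (auto intro!: exI[of _ "C * D"])
qed

lemma mean_bound:
  "integrable \<mu> (\<lambda>u. u) \<and> (\<forall>N. integrable (\<mu>N N) (\<lambda>u. u)) \<and>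
    (\<exists>C\<ge>0. \<forall>N. norm (mean \<mu> - mean (\<mu>N N)) \<le> C * \<psi> N)"
proof -
  obtain D where D: "D \<ge> 0" "\<And>u::'x. norm u \<le> D * exp (a / 2 * (norm u)\<^sup>2)"
    using power_norm_dominated[of 1] by auto
  obtain C where "C \<ge> 0" and "\<forall>(h :: 'x \<Rightarrow> 'x) D. h \<in> borel_measurable borel \<longrightarrow>
      (\<forall>u. norm (h u) \<le> D * exp (a / 2 * (norm u)\<^sup>2)) \<longrightarrow>
      integrable \<mu> h \<and> (\<forall>N. integrable (\<mu>N N) h \<and>
        norm ((\<integral>u. h u \<partial>\<mu>) - (\<integral>u. h u \<partial>\<mu>N N)) \<le> C * D * \<psi> N)"
    using observable_bound[where 'b = 'x] by blast
  note this(2)[rule_format, of "\<lambda>u. u", OF _ D(2)]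
  then show ?thesis using \<open>C \<ge> 0\<close> D(1) by (auto simp: mean_def intro!: exI[of _ "C * D"])
qed

end

section \<open>Covariance operators\<close>

text \<open>Here the Hilbert structure is a hypothesis and not a type class. The classical argument
  applies: \<open>u\<close> minus its projection onto the line of \<open>v\<close> has nonnegative
  squared norm.\<close>

lemma norm_inner_product_cauchy_schwarz:
  assumes "norm_inner_product ip"
  shows "\<bar>ip u v\<bar> \<le> norm u * norm v"
proof (cases "v = 0")
  case True
  have "linear (\<lambda>w. ip w u)" "ip u v = ip v u" using assms by (auto simp: norm_inner_product_def)
  then show ?thesis using True linear_0[of "\<lambda>w. ip w u"] by simp
next
  case False
  have lin: "linear (\<lambda>w. ip w z)" and sym: "ip w z = ip z w" and nrm: "ip w w = (norm w)\<^sup>2" for w z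
    using assms by (auto simp: norm_inner_product_def)
  define t where "t = ip u v / (norm v)\<^sup>2"
  have "0 \<le> ip (u - t *\<^sub>R v) (u - t *\<^sub>R v)" by (simp add: nrm)
  also have "\<dots> = ip u (u - t *\<^sub>R v) - t * ip v (u - t *\<^sub>R v)"
    by (simp add: linear_diff[OF lin] linear_scale[OF lin])
  also have "\<dots> = (norm u)\<^sup>2 - 2 * t * ip u v + t\<^sup>2 * (norm v)\<^sup>2"
    by (subst (1 2) sym) (simp add: linear_diff[OF lin] linear_scale[OF lin] nrm sym[of v u] power2_eq_square algebra_simps)
  also have "\<dots> = (norm u)\<^sup>2 - (ip u v)\<^sup>2 / (norm v)\<^sup>2"
    using False by (simp add: t_def power2_eq_square field_simps)
  finally have "(ip u v)\<^sup>2 \<le> (norm u * norm v)\<^sup>2"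
    using False by (simp add: field_simps power_mult_distrib)
  then have "\<bar>ip u v\<bar> \<le> \<bar>norm u * norm v\<bar>" by (simp only: abs_le_square_iff)
  then show ?thesis by simp
qed

lemma norm_inner_product_bounded_linear:
  assumes "norm_inner_product ip"
  shows "bounded_linear (\<lambda>u. ip u h)"
proof (rule bounded_linear_intro[where K = "norm h"])
  have "linear (\<lambda>u. ip u h)" using assms by (simp add: norm_inner_product_def)
  then show "ip (x + y) h = ip x h + ip y h" "ip (r *\<^sub>R x) h = r *\<^sub>R ip x h" for x y r
    using linear_add[of "\<lambda>u. ip u h"] linear_scale[of "\<lambda>u. ip u h"] by auto
  show "norm (ip u h) \<le> norm u * norm h" for u
    using norm_inner_product_cauchy_schwarz[OF assms] by simp
qed

text \<open>Expanding the centred second moment isolates the integral of an observable that is the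
  same for all measures; only the product of means depends on the measure in a nonlinear
  way.\<close>

lemma
  fixes \<mu> :: "'x::{banach, second_countable_topology} measure"
  assumes ip: "norm_inner_product ip" and "prob_space \<mu>" and sets [measurable_cong]: "sets \<mu> = sets borel"
    and int: "integrable \<mu> (\<lambda>u. (norm u)\<^sup>2)" "integrable \<mu> (\<lambda>u. u)"
  shows integrable_norm_inner_product: "integrable \<mu> (\<lambda>u. ip u h *\<^sub>R u)"
    and covariance_operator_eq:
      "covariance_operator ip \<mu> h = (\<integral>u. ip u h *\<^sub>R u \<partial>\<mu>) - ip (mean \<mu>) h *\<^sub>R mean \<mu>"
    and bounded_linear_covariance_operator: "bounded_linear (covariance_operator ip \<mu>)"
proof -
  interpret prob_space \<mu> by fact
  note bl = norm_inner_product_bounded_linear[OF ip]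
  have [measurable]: "(\<lambda>u. ip u h) \<in> borel_measurable borel" for h
    by (intro borel_measurable_continuous_onI linear_continuous_on bl)
  have bnd: "norm (ip u h *\<^sub>R u) \<le> (norm u)\<^sup>2 * norm h" for u h
    using mult_right_mono[OF norm_inner_product_cauchy_schwarz[OF ip, of u h], of "norm u"]
    by (simp add: power2_eq_square mult_ac)
  show i: "integrable \<mu> (\<lambda>u. ip u h *\<^sub>R u)" for h
  proof (rule Bochner_Integration.integrable_bound)
    show "integrable \<mu> (\<lambda>u. (norm u)\<^sup>2 * norm h)" using int by simp
  qed (use bnd in auto)
  show eq: "covariance_operator ip \<mu> h = (\<integral>u. ip u h *\<^sub>R u \<partial>\<mu>) - ip (mean \<mu>) h *\<^sub>R mean \<mu>" for h
  proof -
    define m where "m = mean \<mu>"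
    have i1: "integrable \<mu> (\<lambda>u. ip u h)" using integrable_bounded_linear[OF bl int(2)] .
    have "covariance_operator ip \<mu> h = (\<integral>u. ip u h *\<^sub>R u - ip u h *\<^sub>R m - (ip m h *\<^sub>R u - ip m h *\<^sub>R m) \<partial>\<mu>)"
      unfolding covariance_operator_def m_def[symmetric]
      by (simp add: linear_diff[OF bounded_linear.linear[OF bl]] algebra_simps)
    also have "\<dots> = (\<integral>u. ip u h *\<^sub>R u \<partial>\<mu>) - (\<integral>u. ip u h \<partial>\<mu>) *\<^sub>R m - (ip m h *\<^sub>R (\<integral>u. u \<partial>\<mu>) - ip m h *\<^sub>R m)"
      using i i1 int by (simp add: prob_space)
    also have "(\<integral>u. ip u h \<partial>\<mu>) = ip m h"
      unfolding m_def mean_def by (rule integral_bounded_linear[OF bl int(2)])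
    finally show ?thesis by (simp add: m_def mean_def)
  qed
  have lin: "linear (ip u)" for u
  proof -
    have "linear (\<lambda>w. ip w u)" "ip u = (\<lambda>w. ip w u)" using ip by (auto simp: norm_inner_product_def)
    then show ?thesis by simp
  qed
  show "bounded_linear (covariance_operator ip \<mu>)"
  proof (rule bounded_linear_intro[where K = "(\<integral>u. (norm u)\<^sup>2 \<partial>\<mu>) + (norm (mean \<mu>))\<^sup>2"])
    show "covariance_operator ip \<mu> (x + y) = covariance_operator ip \<mu> x + covariance_operator ip \<mu> y" for x y
      unfolding eq using i by (simp add: linear_add[OF lin] scaleR_add_left)
    show "covariance_operator ip \<mu> (r *\<^sub>R x) = r *\<^sub>R covariance_operator ip \<mu> x" for r x
      unfolding eq by (simp add: linear_scale[OF lin] scaleR_diff_right flip: scaleR_scaleR)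
    show "norm (covariance_operator ip \<mu> h) \<le> norm h * ((\<integral>u. (norm u)\<^sup>2 \<partial>\<mu>) + (norm (mean \<mu>))\<^sup>2)" for h
    proof -
      have "norm (\<integral>u. ip u h *\<^sub>R u \<partial>\<mu>) \<le> (\<integral>u. (norm u)\<^sup>2 * norm h \<partial>\<mu>)"
        using i int bnd by (intro norm_integral_le_integral) auto
      then show ?thesis
        unfolding eq using norm_triangle_ineq4[of "\<integral>u. ip u h *\<^sub>R u \<partial>\<mu>" "ip (mean \<mu>) h *\<^sub>R mean \<mu>"]
          bnd[of "mean \<mu>" h] by (simp add: algebra_simps)
    qed
  qed
qed

context gibbs_perturbation
begin

text \<open>The second moment is an observable dominated in proportion to \<open>norm h\<close>, so
  the uniform constant of \<open>observable_bound\<close> yields an operator norm bound. The product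
  of means is quadratic and also requires a bound on the means uniform in \<open>N\<close>.\<close>

lemma covariance_bound:
  assumes ip: "norm_inner_product ip"
  shows "bounded_linear (covariance_operator ip \<mu>) \<and>
    (\<forall>N. bounded_linear (covariance_operator ip (\<mu>N N))) \<and>
    (\<exists>C. \<forall>N. onorm (\<lambda>h. covariance_operator ip \<mu> h - covariance_operator ip (\<mu>N N) h) \<le> C * \<psi> N)"
proof -
  obtain D where D: "D \<ge> 0" "\<And>u::'x. (norm u)\<^sup>2 \<le> D * exp (a / 2 * (norm u)\<^sup>2)"
    using power_norm_dominated[of 2] by auto
  obtain C0 where "\<forall>(h :: 'x \<Rightarrow> real) D. h \<in> borel_measurable borel \<longrightarrow>
      (\<forall>u. norm (h u) \<le> D * exp (a / 2 * (norm u)\<^sup>2)) \<longrightarrow>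
      integrable \<mu> h \<and> (\<forall>N. integrable (\<mu>N N) h \<and>
        norm ((\<integral>u. h u \<partial>\<mu>) - (\<integral>u. h u \<partial>\<mu>N N)) \<le> C0 * D * \<psi> N)"
    using observable_bound[where 'b = real] by blast
  from this[rule_format, of "\<lambda>u. (norm u)\<^sup>2" D] D(2)
  have int2: "integrable \<mu> (\<lambda>u. (norm u)\<^sup>2)" "\<And>N. integrable (\<mu>N N) (\<lambda>u. (norm u)\<^sup>2)"
    by auto
  obtain C1 where C1: "C1 \<ge> 0" and obs: "\<forall>(h :: 'x \<Rightarrow> 'x) D. h \<in> borel_measurable borel \<longrightarrow>
      (\<forall>u. norm (h u) \<le> D * exp (a / 2 * (norm u)\<^sup>2)) \<longrightarrow>
      integrable \<mu> h \<and> (\<forall>N. integrable (\<mu>N N) h \<and>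
        norm ((\<integral>u. h u \<partial>\<mu>) - (\<integral>u. h u \<partial>\<mu>N N)) \<le> C1 * D * \<psi> N)"
    using observable_bound[where 'b = 'x] by blast
  obtain C2 where C2: "C2 \<ge> 0" "\<And>N. norm (mean \<mu> - mean (\<mu>N N)) \<le> C2 * \<psi> N"
    and int1: "integrable \<mu> (\<lambda>u. u)" "\<And>N. integrable (\<mu>N N) (\<lambda>u. u)"
    using mean_bound by blast
  obtain B where B: "\<And>N. \<psi> N \<le> B" using \<psi>_bounded by blast
  note bl = norm_inner_product_bounded_linear[OF ip]
  note cs = norm_inner_product_cauchy_schwarz[OF ip]
  have [measurable]: "(\<lambda>u. ip u h) \<in> borel_measurable borel" for h
    by (intro borel_measurable_continuous_onI linear_continuous_on bl)
  note cov = covariance_operator_eq[OF ip prob_space_\<mu>(1) sets_\<mu>(1) int2(1) int1(1)]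
  note covN = covariance_operator_eq[OF ip prob_space_\<mu>(2) sets_\<mu>(2) int2(2) int1(2)]
  \<comment> \<open>The means under \<open>\<mu>N N\<close> stay within \<open>C2 * B\<close> of the
    mean under \<open>\<mu>\<close>; boundedness of \<open>\<psi>\<close> enters here.\<close>
  define R where "R = 2 * norm (mean \<mu>) + C2 * B"
  have R: "norm (mean \<mu>) + norm (mean (\<mu>N N)) \<le> R" for N
  proof -
    have "norm (mean (\<mu>N N)) \<le> norm (mean \<mu>) + norm (mean \<mu> - mean (\<mu>N N))"
      using norm_triangle_sub[of "mean (\<mu>N N)" "mean \<mu>"] by (simp add: norm_minus_commute)
    also have "norm (mean \<mu> - mean (\<mu>N N)) \<le> C2 * B"
      using C2(2)[of N] mult_left_mono[OF B[of N] C2(1)] by simp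
    finally show ?thesis by (simp add: R_def)
  qed
  have "onorm (\<lambda>h. covariance_operator ip \<mu> h - covariance_operator ip (\<mu>N N) h) \<le> (C1 * D + C2 * R) * \<psi> N" for N
  proof (rule onorm_bound)
    have "0 \<le> R" using R[of 0] norm_ge_zero[of "mean \<mu>"] norm_ge_zero[of "mean (\<mu>N 0)"] by linarith
    then show "0 \<le> (C1 * D + C2 * R) * \<psi> N" using C1 C2(1) D(1) \<psi>_nonneg by simp
    fix h
    define m m' where "m = mean \<mu>" and "m' = mean (\<mu>N N)"
    have "norm (ip u h *\<^sub>R u) \<le> D * norm h * exp (a / 2 * (norm u)\<^sup>2)" for u
    proof -
      have "norm (ip u h *\<^sub>R u) \<le> (norm u)\<^sup>2 * norm h"
        using mult_right_mono[OF cs[of u h], of "norm u"] by (simp add: power2_eq_square mult_ac)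
      also have "\<dots> \<le> (D * exp (a / 2 * (norm u)\<^sup>2)) * norm h" using D(2) by (rule mult_right_mono) simp
      finally show ?thesis by (simp add: mult_ac)
    qed
    then have 1: "norm ((\<integral>u. ip u h *\<^sub>R u \<partial>\<mu>) - (\<integral>u. ip u h *\<^sub>R u \<partial>\<mu>N N)) \<le> C1 * (D * norm h) * \<psi> N"
      using obs[rule_format, of "\<lambda>u. ip u h *\<^sub>R u" "D * norm h"] by auto
    \<comment> \<open>Replace one of the two means at a time, so that each term contains
      \<open>m - m'\<close> once.\<close>
    have "ip m h *\<^sub>R m - ip m' h *\<^sub>R m' = ip (m - m') h *\<^sub>R m + ip m' h *\<^sub>R (m - m')"
      by (simp add: linear_diff[OF bounded_linear.linear[OF bl]] algebra_simps)
    also have "norm \<dots> \<le> norm (m - m') * norm h * norm m + norm m' * norm h * norm (m - m')"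
      using cs[of "m - m'" h] cs[of m' h]
      by (intro order_trans[OF norm_triangle_ineq] add_mono) (auto intro!: mult_right_mono)
    also have "\<dots> = norm (m - m') * ((norm m + norm m') * norm h)" by (simp add: algebra_simps)
    also have "\<dots> \<le> (C2 * \<psi> N) * (R * norm h)"
      using C2 R[of N] \<psi>_nonneg[of N] unfolding m_def m'_def
      by (intro mult_mono mult_right_mono) (auto intro: mult_nonneg_nonneg)
    finally have 2: "norm (ip m h *\<^sub>R m - ip m' h *\<^sub>R m') \<le> C2 * \<psi> N * (R * norm h)" .
    have "covariance_operator ip \<mu> h - covariance_operator ip (\<mu>N N) h =
        ((\<integral>u. ip u h *\<^sub>R u \<partial>\<mu>) - (\<integral>u. ip u h *\<^sub>R u \<partial>\<mu>N N)) - (ip m h *\<^sub>R m - ip m' h *\<^sub>R m')"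
      unfolding cov covN m_def m'_def by (simp add: algebra_simps)
    also have "norm \<dots> \<le> C1 * (D * norm h) * \<psi> N + C2 * \<psi> N * (R * norm h)"
      using 1 2 by (rule order_trans[OF norm_triangle_ineq4 add_mono])
    finally show "norm (covariance_operator ip \<mu> h - covariance_operator ip (\<mu>N N) h)
        \<le> (C1 * D + C2 * R) * \<psi> N * norm h"
      by (simp add: algebra_simps)
  qed
  then show ?thesis
    using bounded_linear_covariance_operator[OF ip prob_space_\<mu>(1) sets_\<mu>(1) int2(1) int1(1)]
      bounded_linear_covariance_operator[OF ip prob_space_\<mu>(2) sets_\<mu>(2) int2(2) int1(2)] by blast
qed

end

section \<open>Normalising constants\<close>

text \<open>The potentials are bounded above only on balls, so a lower bound for the normalising
  constants needs a ball that carries mass. A large one does, as the tails vanish.\<close>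

lemma prob_space_ball_pos:
  fixes M :: "'x::{real_normed_vector, second_countable_topology} measure"
  assumes "prob_space M" and sM: "sets M = sets borel"
  obtains r where "r > 0" "measure M {u. norm u < r} > 0"
proof -
  interpret prob_space M by fact
  have meas: "{u::'x. r < norm u} \<in> sets M" "{u::'x. norm u < r} \<in> sets M" for r
    unfolding sM by (intro borel_open open_Collect_less continuous_intros)+
  have "eventually (\<lambda>n. tail M (real n) < 1) sequentially"
    by (rule order_tendstoD[OF tail_tendsto_0[OF assms]]) simp
  then obtain n where "tail M (real n) < 1" by (auto simp: eventually_sequentially)
  then have "0 < measure M (space M - {u. real n < norm u})"
    using prob_compl[OF meas(1)[of "real n"]] by (simp add: tail_def)
  also have "\<dots> \<le> measure M {u. norm u < real n + 1}"
    using meas(2) by (intro finite_measure_mono) auto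
  finally show thesis using that[of "real n + 1"] by simp
qed

text \<open>Restrict the integral to the ball. The resulting bound sees the potential only through
  \<open>L\<close>, which makes it uniform in \<open>N\<close>.\<close>

lemma normalisation_ge:
  fixes M :: "'x::{real_normed_vector, second_countable_topology} measure"
  assumes "prob_space M" and sM [measurable_cong]: "sets M = sets borel"
    and exp_int: "integrable M (\<lambda>u. exp (a * (norm u)\<^sup>2))"
    and V [measurable]: "V \<in> borel_measurable borel"
    and lo: "\<And>u. m - a * (norm u)\<^sup>2 \<le> V u" and up: "\<And>u. norm u < r \<Longrightarrow> V u \<le> L"
  shows "integrable M (\<lambda>u. exp (- V u))"
    and "exp (- L) * measure M {u. norm u < r} \<le> normalisation M V"
proof -
  interpret prob_space M by fact
  have sp: "space M = UNIV" using sM sets_eq_imp_space_eq[of _ borel] by auto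
  have meas [measurable]: "{u::'x. norm u < r} \<in> sets M"
    unfolding sM by (intro borel_open open_Collect_less continuous_intros)
  show int: "integrable M (\<lambda>u. exp (- V u))"
  proof (rule Bochner_Integration.integrable_bound)
    show "integrable M (\<lambda>u. exp (- m) * exp (a * (norm u)\<^sup>2))" using exp_int by simp
    show "AE u in M. norm (exp (- V u)) \<le> norm (exp (- m) * exp (a * (norm u)\<^sup>2))"
      using lo by (simp add: exp_add[symmetric] algebra_simps)
  qed measurable
  have "exp (- L) * measure M {u. norm u < r} = (\<integral>u. exp (- L) * indicator {u. norm u < r} u \<partial>M)"
    using sp by simp
  also have "\<dots> \<le> normalisation M V"
    unfolding normalisation_def
  proof (rule integral_mono)
    show "integrable M (\<lambda>u. exp (- L) * indicator {u. norm u < r} u)"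
      using meas by (intro integrable_mult_right integrable_real_indicator) (auto simp: emeasure_eq_measure)
  qed (use int up in \<open>auto simp: indicator_def\<close>)
  finally show "exp (- L) * measure M {u. norm u < r} \<le> normalisation M V" .
qed

text \<open>Apply \<open>ln q \<le> q - 1\<close> to the quotient of \<open>x\<close> and
  \<open>y\<close> in both orders; \<open>1 / z\<close> is the Lipschitz constant of
  \<open>ln\<close> above \<open>z\<close>.\<close>

lemma abs_ln_diff_le:
  fixes x y z :: real
  assumes "0 < z" "z \<le> x" "z \<le> y"
  shows "\<bar>ln x - ln y\<bar> \<le> \<bar>x - y\<bar> / z"
proof -
  have *: "ln x - ln y \<le> \<bar>x - y\<bar> / z" if "z \<le> x" "z \<le> y" for x y
  proof -
    have "ln x - ln y = ln (x / y)" using that assms(1) by (simp add: ln_div)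
    also have "\<dots> \<le> x / y - 1" using that assms(1) by (intro ln_le_minus_one) simp
    also have "\<dots> = (x - y) / y" using that assms(1) by (simp add: field_simps)
    also have "\<dots> \<le> \<bar>x - y\<bar> / z" using that assms(1) by (intro frac_le) auto
    finally show ?thesis .
  qed
  show ?thesis using *[of x y] *[of y x] assms by (simp add: abs_minus_commute abs_le_iff)
qed

lemma reweighted_measure_eq:
  assumes "normalisation M V > 0"
  shows "reweighted_measure M V = density M (\<lambda>u. ennreal (exp (- (V u + ln (normalisation M V)))))"
  using assms by (simp add: reweighted_measure_def exp_diff exp_minus inverse_eq_divide exp_add mult.commute)

text \<open>Absorbing \<open>ln Z\<close> into the potentials preserves all hypotheses, because \<open>Z\<close> is bounded below
  uniformly in \<open>N\<close> and depends on the potential in a Lipschitz way.\<close>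

lemma gibbs_perturbation_normalised:
  fixes M :: "'x::{banach, second_countable_topology} measure"
  assumes M: "prob_space M" and sM [measurable_cong]: "sets M = sets borel"
    and a: "a > 0" and exp_int: "integrable M (\<lambda>u. exp (a * (norm u)\<^sup>2))"
    and meas [measurable]: "\<Phi> \<in> borel_measurable borel" "\<And>N. \<Phi>N N \<in> borel_measurable borel"
    and lower_bound: "\<forall>\<epsilon>>0. \<exists>M::real. \<forall>u N.
          \<Phi> u \<ge> M - \<epsilon> * (norm u)\<^sup>2 \<and> \<Phi>N N u \<ge> M - \<epsilon> * (norm u)\<^sup>2"
    and upper_bound: "\<forall>r>0. \<exists>L>0::real. \<forall>u N. norm u < r \<longrightarrow> \<Phi> u \<le> L \<and> \<Phi>N N u \<le> L"
    and approximation: "\<forall>\<epsilon>>0. \<exists>K>0::real. \<forall>u N.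
          \<bar>\<Phi> u - \<Phi>N N u\<bar> \<le> K * exp (\<epsilon> * (norm u)\<^sup>2) * \<psi> N"
    and \<psi>_tendsto: "\<psi> \<longlonglongrightarrow> 0"
  shows "normalisation M \<Phi> > 0" "normalisation M (\<Phi>N N) > 0"
    and "gibbs_perturbation M a (\<lambda>u. \<Phi> u + ln (normalisation M \<Phi>))
      (\<lambda>N u. \<Phi>N N u + ln (normalisation M (\<Phi>N N))) \<psi>"
proof -
  interpret prob_space M by fact
  obtain r where r: "r > 0" "measure M {u. norm u < r} > 0"
    using prob_space_ball_pos[OF M sM] by blast
  obtain L where L: "\<And>u N. norm u < r \<Longrightarrow> \<Phi> u \<le> L" "\<And>u N. norm u < r \<Longrightarrow> \<Phi>N N u \<le> L"
    using upper_bound r(1) by meson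
  \<comment> \<open>Only \<open>a / 2\<close> is spent on the lower bound, because the difference of
    the normalising constants below needs another \<open>a / 2\<close> for the approximation
    error.\<close>
  obtain m where m: "\<And>u. m - a / 2 * (norm u)\<^sup>2 \<le> \<Phi> u" "\<And>u N. m - a / 2 * (norm u)\<^sup>2 \<le> \<Phi>N N u"
    using lower_bound a by (meson half_gt_zero)
  have half: "m - a * (norm u)\<^sup>2 \<le> m - a / 2 * (norm u)\<^sup>2" for u :: 'x
    using a by simp
  define z where "z = exp (- L) * measure M {u. norm u < r}"
  have z: "z > 0" using r by (simp add: z_def)
  have Z: "integrable M (\<lambda>u. exp (- \<Phi> u))" "z \<le> normalisation M \<Phi>"
    unfolding z_def using normalisation_ge[OF M sM exp_int meas(1), of m r L] order_trans[OF half m(1)] L(1)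
    by blast+
  have ZN: "integrable M (\<lambda>u. exp (- \<Phi>N N u))" "z \<le> normalisation M (\<Phi>N N)" for N
    unfolding z_def using normalisation_ge[OF M sM exp_int meas(2), of m N r L] order_trans[OF half m(2)] L(2)
    by blast+
  show pos: "normalisation M \<Phi> > 0" "normalisation M (\<Phi>N N) > 0" for N
    using less_le_trans[OF z Z(2)] less_le_trans[OF z ZN(2)] .
  \<comment> \<open>At \<open>u = 0\<close> the approximation bound reads
    \<open>0 \<le> K * \<psi> N\<close>.\<close>
  have \<psi>0: "0 \<le> \<psi> N" for N
  proof -
    obtain K where "K > 0" "\<bar>\<Phi> 0 - \<Phi>N N 0\<bar> \<le> K * exp (1 * (norm (0::'x))\<^sup>2) * \<psi> N"
      using approximation zero_less_one by meson
    then have "0 \<le> K * \<psi> N" using abs_ge_zero[of "\<Phi> 0 - \<Phi>N N 0"] by simp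
    then show ?thesis using \<open>K > 0\<close> by (simp add: zero_le_mult_iff)
  qed
  obtain K where K: "K > 0" "\<And>u N. \<bar>\<Phi> u - \<Phi>N N u\<bar> \<le> K * exp (a / 2 * (norm u)\<^sup>2) * \<psi> N"
    using approximation a by (meson half_gt_zero)
  define E where "E = (\<integral>u. exp (a * (norm u)\<^sup>2) \<partial>M)"
  define C where "C = exp (- m) * K * E / z"
  have C: "C \<ge> 0" using K z by (simp add: C_def E_def)
  have lnZ: "\<bar>ln (normalisation M \<Phi>) - ln (normalisation M (\<Phi>N N))\<bar> \<le> C * \<psi> N" for N
  proof -
    have "normalisation M \<Phi> - normalisation M (\<Phi>N N) = (\<integral>u. exp (- \<Phi> u) - exp (- \<Phi>N N u) \<partial>M)"
      unfolding normalisation_def using Z(1) ZN(1)[of N] by simp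
    also have "norm \<dots> \<le> (\<integral>u. exp (- m) * K * \<psi> N * exp (a * (norm u)\<^sup>2) \<partial>M)"
    proof (rule norm_integral_le_integral)
      fix u
      have "\<bar>exp (- \<Phi> u) - exp (- \<Phi>N N u)\<bar> \<le> exp (- (m - a / 2 * (norm u)\<^sup>2)) * \<bar>\<Phi> u - \<Phi>N N u\<bar>"
        by (rule abs_exp_diff_le) (rule m)+
      also have "\<dots> \<le> exp (- (m - a / 2 * (norm u)\<^sup>2)) * (K * exp (a / 2 * (norm u)\<^sup>2) * \<psi> N)"
        using K(2) by (rule mult_left_mono) simp
      also have "exp (- (m - a / 2 * (norm u)\<^sup>2)) = exp (- m) * exp (a / 2 * (norm u)\<^sup>2)"
        by (simp add: exp_add[symmetric])
      also have "\<dots> * (K * exp (a / 2 * (norm u)\<^sup>2) * \<psi> N) =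
          exp (- m) * K * \<psi> N * (exp (a / 2 * (norm u)\<^sup>2) * exp (a / 2 * (norm u)\<^sup>2))"
        by (simp only: mult_ac)
      also have "exp (a / 2 * (norm u)\<^sup>2) * exp (a / 2 * (norm u)\<^sup>2) = exp (a * (norm u)\<^sup>2)"
        by (simp add: exp_add[symmetric])
      finally show "norm (exp (- \<Phi> u) - exp (- \<Phi>N N u)) \<le> exp (- m) * K * \<psi> N * exp (a * (norm u)\<^sup>2)"
        by simp
    qed (use Z(1) ZN(1)[of N] exp_int in auto)
    also have "\<dots> = exp (- m) * K * E * \<psi> N" by (simp add: E_def)
    finally have "\<bar>normalisation M \<Phi> - normalisation M (\<Phi>N N)\<bar> / z \<le> exp (- m) * K * E * \<psi> N / z"
      using z by (intro divide_right_mono) auto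
    then show ?thesis
      using abs_ln_diff_le[OF z Z(2) ZN(2)[of N]] by (simp add: C_def)
  qed
  have norm1: "(\<integral>u. exp (- (V u + ln (normalisation M V))) \<partial>M) = 1" if "normalisation M V > 0" for V
  proof -
    have "(\<integral>u. exp (- (V u + ln (normalisation M V))) \<partial>M) = (\<integral>u. exp (- V u) / normalisation M V \<partial>M)"
      using that by (intro Bochner_Integration.integral_cong) (simp_all add: exp_diff)
    then show ?thesis using that by (simp add: normalisation_def)
  qed
  show "gibbs_perturbation M a (\<lambda>u. \<Phi> u + ln (normalisation M \<Phi>))
      (\<lambda>N u. \<Phi>N N u + ln (normalisation M (\<Phi>N N))) \<psi>"
  proof (intro gibbs_perturbation.intro gibbs_perturbation_axioms.intro)
    show "\<exists>m. \<forall>u N. m - \<epsilon> * (norm u)\<^sup>2 \<le> \<Phi> u + ln (normalisation M \<Phi>) \<and>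
        m - \<epsilon> * (norm u)\<^sup>2 \<le> \<Phi>N N u + ln (normalisation M (\<Phi>N N))" if "\<epsilon> > 0" for \<epsilon>
    proof -
      obtain m where m: "\<And>u. m - \<epsilon> * (norm u)\<^sup>2 \<le> \<Phi> u" "\<And>u N. m - \<epsilon> * (norm u)\<^sup>2 \<le> \<Phi>N N u"
        using lower_bound \<open>\<epsilon> > 0\<close> by meson
      have lnz: "ln z \<le> ln (normalisation M \<Phi>)" "ln z \<le> ln (normalisation M (\<Phi>N N))" for N
        using z Z(2) ZN(2)[of N] pos by auto
      have "m + ln z - \<epsilon> * (norm u)\<^sup>2 \<le> \<Phi> u + ln (normalisation M \<Phi>) \<and>
        m + ln z - \<epsilon> * (norm u)\<^sup>2 \<le> \<Phi>N N u + ln (normalisation M (\<Phi>N N))" for u N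
        using m(1)[of u] m(2)[of u N] lnz(1) lnz(2)[of N] by linarith
      then show ?thesis by blast
    qed
    show "\<exists>K\<ge>0. \<forall>u N. \<bar>\<Phi> u + ln (normalisation M \<Phi>) - (\<Phi>N N u + ln (normalisation M (\<Phi>N N)))\<bar>
        \<le> K * exp (\<epsilon> * (norm u)\<^sup>2) * \<psi> N" if "\<epsilon> > 0" for \<epsilon>
    proof -
      obtain K where K: "K > 0" "\<And>u N. \<bar>\<Phi> u - \<Phi>N N u\<bar> \<le> K * exp (\<epsilon> * (norm u)\<^sup>2) * \<psi> N"
        using approximation \<open>\<epsilon> > 0\<close> by meson
      have "\<bar>\<Phi> u + ln (normalisation M \<Phi>) - (\<Phi>N N u + ln (normalisation M (\<Phi>N N)))\<bar>
          \<le> (K + C) * exp (\<epsilon> * (norm u)\<^sup>2) * \<psi> N" for u N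
      proof -
        \<comment> \<open>The difference of the logarithms does not depend on \<open>u\<close>; as
          the exponential is at least 1, it can be charged to the constant.\<close>
        have "C * \<psi> N * 1 \<le> C * \<psi> N * exp (\<epsilon> * (norm u)\<^sup>2)"
          using C \<psi>0 \<open>\<epsilon> > 0\<close> by (intro mult_left_mono) auto
        then show ?thesis using K(2)[of u N] lnZ[of N] by (simp add: algebra_simps)
      qed
      then show ?thesis using K C by (intro exI[of _ "K + C"]) auto
    qed
    show "\<exists>B. \<forall>N. \<psi> N \<le> B"
    proof -
      have "Bseq \<psi>" using \<psi>_tendsto by (intro convergent_imp_Bseq convergentI)
      then obtain B where "\<And>N. norm (\<psi> N) \<le> B" by (meson BseqE)
      then show ?thesis by (metis abs_le_D1 real_norm_def)
    qed
  qed (use M sM a exp_int meas pos norm1 \<psi>0 in auto)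
qed

theorem theorem2p4:
  fixes \<mu>0 :: "'h::{real_inner, banach, second_countable_topology} measure"
    and Cov :: "'h \<Rightarrow> 'h"
    and \<iota> :: "'x::{banach, second_countable_topology} \<Rightarrow> 'h"
    and \<Phi> :: "'x \<Rightarrow> real"
    and \<Phi>N :: "nat \<Rightarrow> 'x \<Rightarrow> real"
    and \<psi> :: "nat \<Rightarrow> real"
    and \<mu>X \<mu> :: "'x measure"
    and \<mu>N :: "nat \<Rightarrow> 'x measure"
  assumes gaussian: "gaussian_measure 0 Cov \<mu>0"
    and embedding: "bounded_linear \<iota>" "inj \<iota>"
    and full_measure: "emeasure \<mu>0 (range \<iota>) = 1"
    and \<mu>X: "\<mu>X = measure_on_subspace \<iota> \<mu>0"
    and measurable: "\<Phi> \<in> borel_measurable borel" "\<And>N. \<Phi>N N \<in> borel_measurable borel"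
    and lower_bound: "\<forall>\<epsilon>>0. \<exists>M::real. \<forall>u N.
          \<Phi> u \<ge> M - \<epsilon> * (norm u)\<^sup>2 \<and> \<Phi>N N u \<ge> M - \<epsilon> * (norm u)\<^sup>2"
    and upper_bound: "\<forall>r>0. \<exists>L>0::real. \<forall>u N. norm u < r \<longrightarrow> \<Phi> u \<le> L \<and> \<Phi>N N u \<le> L"
    and approximation: "\<forall>\<epsilon>>0. \<exists>K>0::real. \<forall>u N.
          \<bar>\<Phi> u - \<Phi>N N u\<bar> \<le> K * exp (\<epsilon> * (norm u)\<^sup>2) * \<psi> N"
    and \<psi>_tendsto: "\<psi> \<longlonglongrightarrow> 0"
    and \<mu>: "\<mu> = reweighted_measure \<mu>X \<Phi>"
    and \<mu>N: "\<And>N. \<mu>N N = reweighted_measure \<mu>X (\<Phi>N N)"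
  shows "prob_space \<mu> \<and> (\<forall>N. prob_space (\<mu>N N)) \<and>
    (\<exists>C. \<forall>N \<nu>. sigma_finite_measure \<nu> \<longrightarrow> sets \<nu> = sets borel \<longrightarrow>
        absolutely_continuous \<nu> \<mu> \<longrightarrow> absolutely_continuous \<nu> (\<mu>N N) \<longrightarrow>
        hellinger_dist \<nu> \<mu> (\<mu>N N) \<le> C * \<psi> N) \<and>
    (\<forall>p>0::real.
        integrable \<mu> (\<lambda>u. norm u powr p) \<and> (\<forall>N. integrable (\<mu>N N) (\<lambda>u. norm u powr p)) \<and>
        (\<exists>C. \<forall>N. \<bar>(\<integral>u. norm u powr p \<partial>\<mu>) - (\<integral>u. norm u powr p \<partial>\<mu>N N)\<bar> \<le> C * \<psi> N)) \<and>
    (integrable \<mu> (\<lambda>u. u) \<and> (\<forall>N. integrable (\<mu>N N) (\<lambda>u. u)) \<and>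
        (\<exists>C. \<forall>N. norm (mean \<mu> - mean (\<mu>N N)) \<le> C * \<psi> N)) \<and>
    (\<forall>ip. norm_inner_product ip \<longrightarrow>
        bounded_linear (covariance_operator ip \<mu>) \<and>
        (\<forall>N. bounded_linear (covariance_operator ip (\<mu>N N))) \<and>
        (\<exists>C. \<forall>N. onorm (\<lambda>h. covariance_operator ip \<mu> h - covariance_operator ip (\<mu>N N) h)
                    \<le> C * \<psi> N))"
proof -
  interpret prob_space \<mu>0 using gaussian by (simp add: gaussian_measure_def)
  have s0: "sets \<mu>0 = sets borel" using gaussian by (simp add: gaussian_measure_def)
  have cont: "continuous_on UNIV \<iota>" by (rule linear_continuous_on[OF embedding(1)])
  obtain g where g: "g \<in> borel_measurable \<mu>0" "\<mu>X = distr \<mu>0 borel g"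
      "\<And>x. g (\<iota> x) = x" "AE y in \<mu>0. \<iota> (g y) = y"
    using measure_on_subspace_eq_distr[OF cont embedding(2) prob_space_axioms s0 full_measure] \<mu>X by blast
  have pX: "prob_space \<mu>X" unfolding g(2) by (rule prob_space_distr[OF g(1)])
  have sX: "sets \<mu>X = sets borel" by (simp add: g(2))
  \<comment> \<open>The only trace of Gaussianity that is used on the small space.\<close>
  have "distr (\<mu>X \<Otimes>\<^sub>M \<mu>X) borel rot = \<mu>X \<Otimes>\<^sub>M \<mu>X"
    unfolding g(2)
    by (rule rot_invariant_distr[OF prob_space_axioms s0 gaussian_rot_invariant[OF gaussian]
          bounded_linear.linear[OF embedding(1)] g(1,3,4)])
  then obtain a where a: "a > 0" "integrable \<mu>X (\<lambda>u. exp (a * (norm u)\<^sup>2))"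
    using fernique[OF pX sX] by blast
  note norm = gibbs_perturbation_normalised[OF pX sX a measurable lower_bound upper_bound
      approximation \<psi>_tendsto]
  interpret G: gibbs_perturbation \<mu>X a "\<lambda>u. \<Phi> u + ln (normalisation \<mu>X \<Phi>)"
    "\<lambda>N u. \<Phi>N N u + ln (normalisation \<mu>X (\<Phi>N N))" \<psi>
    by (rule norm(3))
  have "\<mu> = G.\<mu>" unfolding \<mu> G.\<mu>_def by (rule reweighted_measure_eq[OF norm(1)])
  moreover have "\<mu>N = G.\<mu>N"
    by (rule ext) (simp only: \<mu>N G.\<mu>N_def reweighted_measure_eq[OF norm(2)])
  moreover note G.prob_space_\<mu> G.hellinger_bound G.moment_bound G.mean_bound G.covariance_bound
  ultimately show ?thesis by blast
qed

end
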